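(* Suppose that $\mathcal{L}_\phi = k_\phi \mathcal{L}_R$ for a constant $k_\phi>0$ and that $\gamma > \frac{k_\phi}{4V^{\text{nom}}}$. Then the origin of the linear system $\dot{\bar x} = A\bar x$, $\bar{x} = [\bar\omega^T, \bar V^T, \bar\eta^T, \bar\phi^T]^T$ with $\bar\omega,\bar V,\bar\eta\in\mathbb{R}^n$ and $\bar\phi\in\mathbb{R}^{n-1}$, given explicitly by $$\dot{\bar\omega} = M\Big(-(K^{\text{droop}}+K^\omega)\bar\omega + K^V\bar V - K^V(K^\omega)^{-1}K^{\text{droop,I}}\bar\eta - \mathcal{L}_\phi S\bar\phi\Big),$$ $$\dot{\bar V} = \tfrac{1}{V^{\text{nom}}}EK^\omega\bar\omega - E\Big(\mathcal{L}_R + \tfrac{1}{V^{\text{nom}}}K^V\Big)\bar V + \tfrac{1}{V^{\text{nom}}}E\mathcal{L}_\phi S\bar\phi,$$ $$\dot{\bar\eta} = K^{\text{droop,I}}\bar\omega - \mathcal{L}_\eta\bar\eta,$$ $$\dot{\bar\phi} = S^T(K^V)^{-1}K^\omega\bar\omega - \gamma\bar\phi,$$ is globally asymptotically stable.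
   Context: The system is the closed-loop model (in coordinates shifted to the equilibrium, with one unobservable mode removed) of $n$ asynchronous AC areas, each with one HVDC converter, connected through a multi-terminal HVDC (MTDC) grid. The HVDC lines form a connected undirected graph on the vertices $1,\dots,n$; $\mathcal{N}_i$ is the set of neighbors of $i$, and line $\{i,j\}$ has resistance $R_{ij}=R_{ji}>0$. The controllers communicate with neighbors $j\in\mathcal{N}_i$ with weights $c^\eta_{ij}=c^\eta_{ji}>0$ and $c^\phi_{ij}=c^\phi_{ji}>0$. $\mathcal{L}_R$, $\mathcal{L}_\eta$, $\mathcal{L}_\phi$ are the $n\times n$ weighted graph Laplacians with edge weights $1/R_{ij}$, $c^\eta_{ij}$, $c^\phi_{ij}$ respectively. $M=\operatorname{diag}(m_1^{-1},\dots,m_n^{-1})$ with inertias $m_i>0$; $E=\operatorname{diag}(C_1^{-1},\dots,C_n^{-1})$ with capacitances $C_i>0$; $V^{\text{nom}}>0$ is a nominal voltage; $\gamma>0$ is a scalar controller gain. $K^\omega$, $K^V$, $K^{\text{droop}}$, $K^{\text{droop,I}}$ are diagonal $n\times n$ matrices of controller gains with positive diagonal entries $K^\omega_i$, $K^V_i$, $K^{\text{droop}}_i$, $K^{\text{droop,I}}_i$. $1_n\in\mathbb{R}^n$ is the all-ones vector, and $S$ is an $n\times(n-1)$ matrix such that $\left[\frac{1}{\sqrt n}1_n \;\; S\right]$ is an orthogonal matrix. *)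

theory Defs
  imports
    Complex_Main
    "Jordan_Normal_Form.Matrix"
    "Graph_Theory.Digraph_Component"
begin

text \<open>
  Vertices are numbered \<open>0, \<dots>, n - 1\<close>, in line with the indexing of vectors and matrices.
  The neighbours of \<open>i\<close> are the \<open>j\<close> with \<open>(i, j) \<in> parcs G\<close>, and the values of \<open>w\<close> off the
  edges are irrelevant. The diagonal entry is the weighted degree only for loop-free \<open>G\<close>.
\<close>

definition weighted_laplacian ::
    "nat \<Rightarrow> nat pair_pre_digraph \<Rightarrow> (nat \<Rightarrow> nat \<Rightarrow> real) \<Rightarrow> real mat" where
  "weighted_laplacian n G w = mat n n (\<lambda>(i, j).
     if i = j then (\<Sum>k \<in> {k \<in> {0..<n}. (i, k) \<in> parcs G}. w i k)
     else if (i, j) \<in> parcs G then - w i j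
     else 0)"

definition edge_weights :: "nat pair_pre_digraph \<Rightarrow> (nat \<Rightarrow> nat \<Rightarrow> real) \<Rightarrow> bool" where
  "edge_weights G w \<longleftrightarrow> (\<forall>(i, j) \<in> parcs G. w i j = w j i \<and> w i j > 0)"

text \<open>
  Unlike \<^const>\<open>orthogonal_mat\<close>, which only asks for nonzero, pairwise orthogonal columns, this
  is orthogonality in the usual sense.
\<close>

definition is_orthogonal :: "real mat \<Rightarrow> bool" where
  "is_orthogonal Q \<longleftrightarrow>
     square_mat Q \<and> inverts_mat (transpose_mat Q) Q \<and> inverts_mat Q (transpose_mat Q)"

text \<open>
  For \<open>S\<close> with \<open>n\<close> rows, this is the matrix whose first column is the all-ones vector divided
  by \<open>sqrt n\<close> and whose remaining columns are those of \<open>S\<close>.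
\<close>

definition ones_augmented :: "nat \<Rightarrow> real mat \<Rightarrow> real mat" where
  "ones_augmented n S = mat_of_cols n ((1 / sqrt (real n)) \<cdot>\<^sub>v vec n (\<lambda>_. 1) # cols S)"

definition eucl_norm :: "real vec \<Rightarrow> real" where
  "eucl_norm v = sqrt (v \<bullet> v)"

definition linear_system_solution :: "real mat \<Rightarrow> (real \<Rightarrow> real vec) \<Rightarrow> bool" where
  "linear_system_solution A x \<longleftrightarrow>
     (\<forall>t \<ge> 0. x t \<in> carrier_vec (dim_col A) \<and>
       (\<forall>i < dim_row A.
         ((\<lambda>s. x s $ i) has_real_derivative (A *\<^sub>v x t) $ i) (at t within {0..})))"

text \<open>
  Lyapunov stability together with convergence to the origin from every initial state. The
  quantification over solutions on \<open>[0, \<infinity>)\<close> loses nothing: every initial value problem of a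
  linear system with constant coefficients has exactly one solution there.
\<close>

definition globally_asymptotically_stable :: "real mat \<Rightarrow> bool" where
  "globally_asymptotically_stable A \<longleftrightarrow>
     square_mat A \<and>
     (\<forall>\<epsilon> > 0. \<exists>\<delta> > 0. \<forall>x. linear_system_solution A x \<and> eucl_norm (x 0) < \<delta> \<longrightarrow>
        (\<forall>t \<ge> 0. eucl_norm (x t) < \<epsilon>)) \<and>
     (\<forall>x. linear_system_solution A x \<longrightarrow> ((\<lambda>t. eucl_norm (x t)) \<longlongrightarrow> 0) at_top)"

text \<open>
  The system matrix, partitioned according to the state \<open>\<omega> @\<^sub>v V @\<^sub>v \<eta> @\<^sub>v \<phi>\<close> with blocks of
  dimension \<open>n\<close>, \<open>n\<close>, \<open>n\<close>, \<open>n - 1\<close>. The diagonal matrices \<open>M\<close>, \<open>E\<close> and the gain matrices are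
  given by the functions \<open>m\<close> (inertias), \<open>C\<close> (capacitances) and \<open>k\<omega>\<close>, \<open>kV\<close>, \<open>kD\<close> (droop),
  \<open>kI\<close> (droop, integral). Lemma \<open>closed_loop_matrix_mult\<close> gives the four equations.
\<close>

definition closed_loop_matrix ::
    "nat \<Rightarrow> real \<Rightarrow> real \<Rightarrow> (nat \<Rightarrow> real) \<Rightarrow> (nat \<Rightarrow> real) \<Rightarrow>
     (nat \<Rightarrow> real) \<Rightarrow> (nat \<Rightarrow> real) \<Rightarrow> (nat \<Rightarrow> real) \<Rightarrow> (nat \<Rightarrow> real) \<Rightarrow>
     real mat \<Rightarrow> real mat \<Rightarrow> real mat \<Rightarrow> real mat \<Rightarrow> real mat" where
  "closed_loop_matrix n Vnom \<gamma> m C k\<omega> kV kD kI L\<^sub>R L\<^sub>\<eta> L\<^sub>\<phi> S =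
    (let M = mat_diag n (\<lambda>i. inverse (m i));
         E = mat_diag n (\<lambda>i. inverse (C i));
         K\<omega> = mat_diag n k\<omega>;
         K\<omega>inv = mat_diag n (\<lambda>i. inverse (k\<omega> i));
         KV = mat_diag n kV;
         KVinv = mat_diag n (\<lambda>i. inverse (kV i));
         KD = mat_diag n kD;
         KI = mat_diag n kI
     in four_block_mat
          (four_block_mat
            (- (M * (KD + K\<omega>)))              (M * KV)
            ((1 / Vnom) \<cdot>\<^sub>m (E * K\<omega>))         (- (E * (L\<^sub>R + (1 / Vnom) \<cdot>\<^sub>m KV))))
          (four_block_mat
            (- (M * (KV * K\<omega>inv * KI)))      (- (M * (L\<^sub>\<phi> * S)))
            (0\<^sub>m n n)                          ((1 / Vnom) \<cdot>\<^sub>m (E * (L\<^sub>\<phi> * S))))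
          (four_block_mat
            KI                                (0\<^sub>m n n)
            (transpose_mat S * KVinv * K\<omega>)   (0\<^sub>m (n - 1) n))
          (four_block_mat
            (- L\<^sub>\<eta>)                            (0\<^sub>m n (n - 1))
            (0\<^sub>m (n - 1) n)                    (- (\<gamma> \<cdot>\<^sub>m 1\<^sub>m (n - 1)))))"

lemma uminus_mult_mat_vec_carrier:
  fixes A :: "real mat"
  assumes "A \<in> carrier_mat nr nc" "v \<in> carrier_vec nc"
  shows "(- A) *\<^sub>v v = - (A *\<^sub>v v)"
  using assms by (intro eq_vecI) auto

lemma smult_mult_mat_vec_carrier:
  fixes A :: "real mat"
  assumes "A \<in> carrier_mat nr nc" "v \<in> carrier_vec nc"
  shows "(a \<cdot>\<^sub>m A) *\<^sub>v v = a \<cdot>\<^sub>v (A *\<^sub>v v)"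
  using assms by (intro eq_vecI) auto

lemma zero_mult_mat_vec_carrier:
  fixes v :: "real vec"
  assumes "v \<in> carrier_vec nc"
  shows "0\<^sub>m nr nc *\<^sub>v v = 0\<^sub>v nr"
  using assms by (intro eq_vecI) auto

lemma append_vec_add_carrier:
  fixes a b c d :: "real vec"
  assumes "a \<in> carrier_vec k" "b \<in> carrier_vec l" "c \<in> carrier_vec k" "d \<in> carrier_vec l"
  shows "(a @\<^sub>v b) + (c @\<^sub>v d) = (a + c) @\<^sub>v (b + d)"
  using assms by (intro eq_vecI) auto

lemma append_vec_assoc_carrier:
  fixes a b c :: "real vec"
  shows "(a @\<^sub>v b) @\<^sub>v c = a @\<^sub>v (b @\<^sub>v c)"
  by (intro eq_vecI) auto

lemma closed_loop_matrix_mult: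
  assumes L: "L\<^sub>R \<in> carrier_mat n n" "L\<^sub>\<eta> \<in> carrier_mat n n" "L\<^sub>\<phi> \<in> carrier_mat n n"
    and S: "S \<in> carrier_mat n (n - 1)"
    and x: "\<omega> \<in> carrier_vec n" "V \<in> carrier_vec n" "\<eta> \<in> carrier_vec n" "\<phi> \<in> carrier_vec (n - 1)"
    and M: "M = mat_diag n (\<lambda>i. inverse (m i))"
    and E: "E = mat_diag n (\<lambda>i. inverse (C i))"
    and K\<omega>: "K\<omega> = mat_diag n k\<omega>" and K\<omega>inv: "K\<omega>inv = mat_diag n (\<lambda>i. inverse (k\<omega> i))"
    and KV: "KV = mat_diag n kV" and KVinv: "KVinv = mat_diag n (\<lambda>i. inverse (kV i))"
    and KD: "KD = mat_diag n kD" and KI: "KI = mat_diag n kI"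
  shows "closed_loop_matrix n Vnom \<gamma> m C k\<omega> kV kD kI L\<^sub>R L\<^sub>\<eta> L\<^sub>\<phi> S *\<^sub>v (\<omega> @\<^sub>v V @\<^sub>v \<eta> @\<^sub>v \<phi>) =
      (M *\<^sub>v (- ((KD + K\<omega>) *\<^sub>v \<omega>) + KV *\<^sub>v V - (KV * K\<omega>inv * KI) *\<^sub>v \<eta> - (L\<^sub>\<phi> * S) *\<^sub>v \<phi>))
      @\<^sub>v ((1 / Vnom) \<cdot>\<^sub>v ((E * K\<omega>) *\<^sub>v \<omega>) - (E * (L\<^sub>R + (1 / Vnom) \<cdot>\<^sub>m KV)) *\<^sub>v V
          + (1 / Vnom) \<cdot>\<^sub>v ((E * (L\<^sub>\<phi> * S)) *\<^sub>v \<phi>))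
      @\<^sub>v (KI *\<^sub>v \<omega> - L\<^sub>\<eta> *\<^sub>v \<eta>)
      @\<^sub>v ((transpose_mat S * KVinv * K\<omega>) *\<^sub>v \<omega> - \<gamma> \<cdot>\<^sub>v \<phi>)"
    (is "_ = ?w @\<^sub>v ?v @\<^sub>v ?e @\<^sub>v ?p")
proof -
  have D: "M \<in> carrier_mat n n" "E \<in> carrier_mat n n" "K\<omega> \<in> carrier_mat n n"
    "K\<omega>inv \<in> carrier_mat n n" "KV \<in> carrier_mat n n" "KVinv \<in> carrier_mat n n"
    "KD \<in> carrier_mat n n" "KI \<in> carrier_mat n n"
    unfolding M E K\<omega> K\<omega>inv KV KVinv KD KI by simp_all
  define A11 where "A11 = - (M * (KD + K\<omega>))"
  define A12 where "A12 = M * KV"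
  define A21 where "A21 = (1 / Vnom) \<cdot>\<^sub>m (E * K\<omega>)"
  define A22 where "A22 = - (E * (L\<^sub>R + (1 / Vnom) \<cdot>\<^sub>m KV))"
  define A13 where "A13 = - (M * (KV * K\<omega>inv * KI))"
  define A14 where "A14 = - (M * (L\<^sub>\<phi> * S))"
  define A24 where "A24 = (1 / Vnom) \<cdot>\<^sub>m (E * (L\<^sub>\<phi> * S))"
  define A41 where "A41 = transpose_mat S * KVinv * K\<omega>"
  define A44 where "A44 = - (\<gamma> \<cdot>\<^sub>m (1\<^sub>m (n - 1) :: real mat))"
  have c: "A11 \<in> carrier_mat n n" "A12 \<in> carrier_mat n n" "A21 \<in> carrier_mat n n"
    "A22 \<in> carrier_mat n n" "A13 \<in> carrier_mat n n" "A14 \<in> carrier_mat n (n - 1)"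
    "A24 \<in> carrier_mat n (n - 1)" "A41 \<in> carrier_mat (n - 1) n" "A44 \<in> carrier_mat (n - 1) (n - 1)"
    "0\<^sub>m n n \<in> carrier_mat n n" "0\<^sub>m n (n - 1) \<in> carrier_mat n (n - 1)"
    "0\<^sub>m (n - 1) n \<in> carrier_mat (n - 1) n" "- L\<^sub>\<eta> \<in> carrier_mat n n"
    using D L S
    unfolding A11_def A12_def A21_def A22_def A13_def A14_def A24_def A41_def A44_def
    by (auto intro!: mult_carrier_mat)
  have sum4: "closed_loop_matrix n Vnom \<gamma> m C k\<omega> kV kD kI L\<^sub>R L\<^sub>\<eta> L\<^sub>\<phi> S *\<^sub>v (\<omega> @\<^sub>v V @\<^sub>v \<eta> @\<^sub>v \<phi>) =
     ((A11 *\<^sub>v \<omega> + A12 *\<^sub>v V + (A13 *\<^sub>v \<eta> + A14 *\<^sub>v \<phi>)) @\<^sub>v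
      (A21 *\<^sub>v \<omega> + A22 *\<^sub>v V + (0\<^sub>m n n *\<^sub>v \<eta> + A24 *\<^sub>v \<phi>))) @\<^sub>v
     ((KI *\<^sub>v \<omega> + 0\<^sub>m n n *\<^sub>v V + ((- L\<^sub>\<eta>) *\<^sub>v \<eta> + 0\<^sub>m n (n - 1) *\<^sub>v \<phi>)) @\<^sub>v
      (A41 *\<^sub>v \<omega> + 0\<^sub>m (n - 1) n *\<^sub>v V + (0\<^sub>m (n - 1) n *\<^sub>v \<eta> + A44 *\<^sub>v \<phi>)))"
  proof -
    have "closed_loop_matrix n Vnom \<gamma> m C k\<omega> kV kD kI L\<^sub>R L\<^sub>\<eta> L\<^sub>\<phi> S =
       four_block_mat (four_block_mat A11 A12 A21 A22) (four_block_mat A13 A14 (0\<^sub>m n n) A24)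
         (four_block_mat KI (0\<^sub>m n n) A41 (0\<^sub>m (n - 1) n))
         (four_block_mat (- L\<^sub>\<eta>) (0\<^sub>m n (n - 1)) (0\<^sub>m (n - 1) n) A44)"
      unfolding closed_loop_matrix_def Let_def A11_def A12_def A21_def A22_def A13_def A14_def
        A24_def A41_def A44_def M E K\<omega> K\<omega>inv KV KVinv KD KI by simp
    moreover have "\<omega> @\<^sub>v V @\<^sub>v \<eta> @\<^sub>v \<phi> = (\<omega> @\<^sub>v V) @\<^sub>v (\<eta> @\<^sub>v \<phi>)"
      by (simp only: append_vec_assoc_carrier)
    moreover have "four_block_mat (four_block_mat A11 A12 A21 A22)
         (four_block_mat A13 A14 (0\<^sub>m n n) A24)
         (four_block_mat KI (0\<^sub>m n n) A41 (0\<^sub>m (n - 1) n))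
         (four_block_mat (- L\<^sub>\<eta>) (0\<^sub>m n (n - 1)) (0\<^sub>m (n - 1) n) A44)
         *\<^sub>v ((\<omega> @\<^sub>v V) @\<^sub>v (\<eta> @\<^sub>v \<phi>)) =
       (four_block_mat A11 A12 A21 A22 *\<^sub>v (\<omega> @\<^sub>v V)
         + four_block_mat A13 A14 (0\<^sub>m n n) A24 *\<^sub>v (\<eta> @\<^sub>v \<phi>)) @\<^sub>v
       (four_block_mat KI (0\<^sub>m n n) A41 (0\<^sub>m (n - 1) n) *\<^sub>v (\<omega> @\<^sub>v V)
         + four_block_mat (- L\<^sub>\<eta>) (0\<^sub>m n (n - 1)) (0\<^sub>m (n - 1) n) A44 *\<^sub>v (\<eta> @\<^sub>v \<phi>))"
      by (rule four_block_mat_mult_vec[of _ "n + n" "n + n" _ "n + (n - 1)" _ "n + (n - 1)"])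
        (use c D x in \<open>auto simp: four_block_carrier_mat\<close>)
    moreover have "four_block_mat A11 A12 A21 A22 *\<^sub>v (\<omega> @\<^sub>v V) =
        (A11 *\<^sub>v \<omega> + A12 *\<^sub>v V) @\<^sub>v (A21 *\<^sub>v \<omega> + A22 *\<^sub>v V)"
      by (rule four_block_mat_mult_vec[of _ n n _ n _ n]) (use c x in auto)
    moreover have "four_block_mat A13 A14 (0\<^sub>m n n) A24 *\<^sub>v (\<eta> @\<^sub>v \<phi>) =
        (A13 *\<^sub>v \<eta> + A14 *\<^sub>v \<phi>) @\<^sub>v (0\<^sub>m n n *\<^sub>v \<eta> + A24 *\<^sub>v \<phi>)"
      by (rule four_block_mat_mult_vec[of _ n n _ "n - 1" _ n]) (use c x in auto)
    moreover have "four_block_mat KI (0\<^sub>m n n) A41 (0\<^sub>m (n - 1) n) *\<^sub>v (\<omega> @\<^sub>v V) =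
        (KI *\<^sub>v \<omega> + 0\<^sub>m n n *\<^sub>v V) @\<^sub>v (A41 *\<^sub>v \<omega> + 0\<^sub>m (n - 1) n *\<^sub>v V)"
      by (rule four_block_mat_mult_vec[of _ n n _ n _ "n - 1"]) (use c D x in auto)
    moreover have "four_block_mat (- L\<^sub>\<eta>) (0\<^sub>m n (n - 1)) (0\<^sub>m (n - 1) n) A44 *\<^sub>v (\<eta> @\<^sub>v \<phi>) =
        ((- L\<^sub>\<eta>) *\<^sub>v \<eta> + 0\<^sub>m n (n - 1) *\<^sub>v \<phi>) @\<^sub>v (0\<^sub>m (n - 1) n *\<^sub>v \<eta> + A44 *\<^sub>v \<phi>)"
      by (rule four_block_mat_mult_vec[of _ n n _ "n - 1" _ "n - 1"]) (use c x in auto)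
    ultimately have "closed_loop_matrix n Vnom \<gamma> m C k\<omega> kV kD kI L\<^sub>R L\<^sub>\<eta> L\<^sub>\<phi> S *\<^sub>v (\<omega> @\<^sub>v V @\<^sub>v \<eta> @\<^sub>v \<phi>) =
       (((A11 *\<^sub>v \<omega> + A12 *\<^sub>v V) @\<^sub>v (A21 *\<^sub>v \<omega> + A22 *\<^sub>v V))
         + ((A13 *\<^sub>v \<eta> + A14 *\<^sub>v \<phi>) @\<^sub>v (0\<^sub>m n n *\<^sub>v \<eta> + A24 *\<^sub>v \<phi>))) @\<^sub>v
       (((KI *\<^sub>v \<omega> + 0\<^sub>m n n *\<^sub>v V) @\<^sub>v (A41 *\<^sub>v \<omega> + 0\<^sub>m (n - 1) n *\<^sub>v V))
         + (((- L\<^sub>\<eta>) *\<^sub>v \<eta> + 0\<^sub>m n (n - 1) *\<^sub>v \<phi>) @\<^sub>v (0\<^sub>m (n - 1) n *\<^sub>v \<eta> + A44 *\<^sub>v \<phi>)))"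
      by (simp only:)
    also have "((A11 *\<^sub>v \<omega> + A12 *\<^sub>v V) @\<^sub>v (A21 *\<^sub>v \<omega> + A22 *\<^sub>v V))
         + ((A13 *\<^sub>v \<eta> + A14 *\<^sub>v \<phi>) @\<^sub>v (0\<^sub>m n n *\<^sub>v \<eta> + A24 *\<^sub>v \<phi>)) =
       (A11 *\<^sub>v \<omega> + A12 *\<^sub>v V + (A13 *\<^sub>v \<eta> + A14 *\<^sub>v \<phi>)) @\<^sub>v
       (A21 *\<^sub>v \<omega> + A22 *\<^sub>v V + (0\<^sub>m n n *\<^sub>v \<eta> + A24 *\<^sub>v \<phi>))"
      by (rule append_vec_add_carrier[of _ n _ n];
          rule add_carrier_vec mult_mat_vec_carrier; rule c x mult_mat_vec_carrier; rule c x)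
    also have "((KI *\<^sub>v \<omega> + 0\<^sub>m n n *\<^sub>v V) @\<^sub>v (A41 *\<^sub>v \<omega> + 0\<^sub>m (n - 1) n *\<^sub>v V))
         + (((- L\<^sub>\<eta>) *\<^sub>v \<eta> + 0\<^sub>m n (n - 1) *\<^sub>v \<phi>) @\<^sub>v (0\<^sub>m (n - 1) n *\<^sub>v \<eta> + A44 *\<^sub>v \<phi>)) =
       (KI *\<^sub>v \<omega> + 0\<^sub>m n n *\<^sub>v V + ((- L\<^sub>\<eta>) *\<^sub>v \<eta> + 0\<^sub>m n (n - 1) *\<^sub>v \<phi>)) @\<^sub>v
       (A41 *\<^sub>v \<omega> + 0\<^sub>m (n - 1) n *\<^sub>v V + (0\<^sub>m (n - 1) n *\<^sub>v \<eta> + A44 *\<^sub>v \<phi>))"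
      by (rule append_vec_add_carrier[of _ n _ "n - 1"];
          rule add_carrier_vec mult_mat_vec_carrier; rule c D x mult_mat_vec_carrier; rule c D x)
    finally show ?thesis .
  qed
  have w: "A11 *\<^sub>v \<omega> + A12 *\<^sub>v V + (A13 *\<^sub>v \<eta> + A14 *\<^sub>v \<phi>) = ?w"
  proof -
    define a where "a = (KD + K\<omega>) *\<^sub>v \<omega>"
    define b where "b = KV *\<^sub>v V"
    define d where "d = (KV * K\<omega>inv * KI) *\<^sub>v \<eta>"
    define e where "e = (L\<^sub>\<phi> * S) *\<^sub>v \<phi>"
    have car: "a \<in> carrier_vec n" "b \<in> carrier_vec n" "d \<in> carrier_vec n" "e \<in> carrier_vec n"
      using D L S x unfolding a_def b_def d_def e_def by (auto intro!: mult_mat_vec_carrier)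
    have KK: "KV * K\<omega>inv * KI \<in> carrier_mat n n" "L\<^sub>\<phi> * S \<in> carrier_mat n (n - 1)"
      "KD + K\<omega> \<in> carrier_mat n n"
      using D L S by auto
    have 1: "A11 *\<^sub>v \<omega> = - (M *\<^sub>v a)"
      unfolding A11_def a_def
      by (simp add: uminus_mult_mat_vec_carrier[OF mult_carrier_mat[OF D(1) KK(3)] x(1)]
          assoc_mult_mat_vec[OF D(1) KK(3) x(1)])
    have 2: "A12 *\<^sub>v V = M *\<^sub>v b"
      unfolding A12_def b_def by (rule assoc_mult_mat_vec[OF D(1) D(5) x(2)])
    have 3: "A13 *\<^sub>v \<eta> = - (M *\<^sub>v d)"
      unfolding A13_def d_def
      by (simp add: uminus_mult_mat_vec_carrier[OF mult_carrier_mat[OF D(1) KK(1)] x(3)]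
          assoc_mult_mat_vec[OF D(1) KK(1) x(3)])
    have 4: "A14 *\<^sub>v \<phi> = - (M *\<^sub>v e)"
      unfolding A14_def e_def
      by (simp add: uminus_mult_mat_vec_carrier[OF mult_carrier_mat[OF D(1) KK(2)] x(4)]
          assoc_mult_mat_vec[OF D(1) KK(2) x(4)])
    have "M *\<^sub>v (- a + b - d - e) = - (M *\<^sub>v a) + M *\<^sub>v b + (- (M *\<^sub>v d) + - (M *\<^sub>v e))"
      using car D(1)
      by (intro eq_vecI)
        (auto simp: M mat_diag_def scalar_prod_def algebra_simps sum.distrib sum_subtractf sum_negf)
    then show ?thesis
      unfolding 1 2 3 4 by (simp add: a_def b_def d_def e_def)
  qed
  have v: "A21 *\<^sub>v \<omega> + A22 *\<^sub>v V + (0\<^sub>m n n *\<^sub>v \<eta> + A24 *\<^sub>v \<phi>) = ?v"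
  proof -
    have KK: "E * K\<omega> \<in> carrier_mat n n" "E * (L\<^sub>R + (1 / Vnom) \<cdot>\<^sub>m KV) \<in> carrier_mat n n"
      "E * (L\<^sub>\<phi> * S) \<in> carrier_mat n (n - 1)"
      using D L S by auto
    show ?thesis
      unfolding A21_def A22_def A24_def smult_mult_mat_vec_carrier[OF KK(1) x(1)]
        smult_mult_mat_vec_carrier[OF KK(3) x(4)] uminus_mult_mat_vec_carrier[OF KK(2) x(2)]
        zero_mult_mat_vec_carrier[OF x(3)]
      using KK by (intro eq_vecI) auto
  qed
  have e: "KI *\<^sub>v \<omega> + 0\<^sub>m n n *\<^sub>v V + ((- L\<^sub>\<eta>) *\<^sub>v \<eta> + 0\<^sub>m n (n - 1) *\<^sub>v \<phi>) = ?e"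
    unfolding zero_mult_mat_vec_carrier[OF x(2)] zero_mult_mat_vec_carrier[OF x(4)]
      uminus_mult_mat_vec_carrier[OF L(2) x(3)]
    using D L x by (intro eq_vecI) auto
  have p: "A41 *\<^sub>v \<omega> + 0\<^sub>m (n - 1) n *\<^sub>v V + (0\<^sub>m (n - 1) n *\<^sub>v \<eta> + A44 *\<^sub>v \<phi>) = ?p"
  proof -
    have "A44 *\<^sub>v \<phi> = - (\<gamma> \<cdot>\<^sub>v \<phi>)"
      unfolding A44_def
      using x(4) by (subst uminus_mult_mat_vec_carrier[of _ "n - 1" "n - 1"])
        (auto simp: smult_mult_mat_vec_carrier[of _ "n - 1" "n - 1"])
    then show ?thesis
      unfolding zero_mult_mat_vec_carrier[OF x(2)] zero_mult_mat_vec_carrier[OF x(3)]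
      using c(8) x unfolding A41_def by (intro eq_vecI) auto
  qed
  show ?thesis
    unfolding sum4 w v e p by (rule append_vec_assoc_carrier)
qed

end

theory Submission
  imports Defs "HOL-Analysis.Convex"
begin

text \<open>
  Put \<open>y = S \<phi>\<close> and \<open>u = k\<omega> / kV\<close>. Along solutions, half of
  \<open>\<Sum> u m \<omega>\<^sup>2 + Vnom \<Sum> C V\<^sup>2 + \<Sum> \<eta>\<^sup>2 + y \<bullet> L\<^sub>\<phi> y\<close> has derivative
  \<open>- \<Sum> u kD \<omega>\<^sup>2 - \<Sum> (k\<omega> \<omega> - kV V)\<^sup>2 / kV - \<eta> \<bullet> L\<^sub>\<eta> \<eta>\<close> minus the form
  \<open>Vnom V \<bullet> L\<^sub>R V - k\<phi> V \<bullet> L\<^sub>R y + \<gamma> k\<phi> y \<bullet> L\<^sub>R y\<close>, which dominates a positive multiple of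
  \<open>y \<bullet> L\<^sub>R y\<close> exactly because \<open>\<gamma> > k\<phi> / (4 Vnom)\<close>; and \<open>y\<close> is orthogonal to the all-ones
  vector, so by connectedness \<open>y \<bullet> L\<^sub>R y\<close> controls \<open>y\<close>. Only constant \<open>\<eta>\<close> is not damped. Instead of
  LaSalle's invariance principle, a small multiple of \<open>\<Sum> u m \<omega> \<eta>\<close> is added, which makes the
  Lyapunov function strict and the decay exponential.
\<close>

section \<open>Elementary inequalities and uniform bounds over finite index sets\<close>

lemma mult_le_young:
  fixes x y t :: real
  assumes "t > 0"
  shows "x * y \<le> t * x\<^sup>2 + y\<^sup>2 / (4 * t)"
proof -
  have "0 \<le> (2 * t * x - y)\<^sup>2 / (4 * t)"
    using assms by simp
  also have "\<dots> = t * x\<^sup>2 + y\<^sup>2 / (4 * t) - x * y"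
    using assms by (simp add: field_simps power2_eq_square)
  finally show ?thesis by simp
qed

lemma finite_pos_lower_bound:
  fixes f :: "'a \<Rightarrow> real"
  assumes "finite A" "\<And>i. i \<in> A \<Longrightarrow> f i > 0"
  obtains c where "c > 0" "\<And>i. i \<in> A \<Longrightarrow> c \<le> f i"
proof
  \<comment> \<open>The inserted 1 covers an empty \<open>A\<close>, where the image alone has no
    meaningful minimum.\<close>
  show "Min (insert 1 (f ` A)) > 0"
    using assms by auto
  show "Min (insert 1 (f ` A)) \<le> f i" if "i \<in> A" for i
    using assms(1) that by auto
qed

lemma finite_pos_upper_bound:
  fixes f :: "'a \<Rightarrow> real"
  assumes "finite A"
  obtains c where "c > 0" "\<And>i. i \<in> A \<Longrightarrow> f i \<le> c"
proof
  show "Max (insert 1 (f ` A)) > 0"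
    using assms by (auto simp: Max_gr_iff)
  show "f i \<le> Max (insert 1 (f ` A))" if "i \<in> A" for i
    using assms that by auto
qed

section \<open>Weighted Laplacians and their Dirichlet forms\<close>

text \<open>Weights are total functions, meant to be zero off the edges, so that sums run over all
  indices; \<open>a i i\<close> drops out.\<close>

definition laplacian :: "nat \<Rightarrow> (nat \<Rightarrow> nat \<Rightarrow> real) \<Rightarrow> (nat \<Rightarrow> real) \<Rightarrow> nat \<Rightarrow> real" where
  "laplacian n a x i = (\<Sum>j<n. a i j * (x i - x j))"

text \<open>For symmetric weights, the bilinear form of the Laplacian; the division by 2 compensates
  for counting each edge in both orders.\<close>

definition dirichlet :: "nat \<Rightarrow> (nat \<Rightarrow> nat \<Rightarrow> real) \<Rightarrow> (nat \<Rightarrow> real) \<Rightarrow> (nat \<Rightarrow> real) \<Rightarrow> real" where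
  "dirichlet n a x y = (\<Sum>i<n. \<Sum>j<n. a i j * (x i - x j) * (y i - y j)) / 2"

text \<open>Summation by parts: exchanging \<open>i\<close> and \<open>j\<close> and using symmetry
  replaces \<open>z i\<close> by \<open>- z j\<close>, and the average of the two expressions is the
  Dirichlet form.\<close>

lemma sum_mult_laplacian:
  assumes "\<And>i j. a i j = a j i"
  shows "(\<Sum>i<n. z i * laplacian n a x i) = dirichlet n a z x"
proof -
  have "(\<Sum>i<n. z i * laplacian n a x i) = (\<Sum>i<n. \<Sum>j<n. a i j * z i * (x i - x j))"
    by (simp add: laplacian_def sum_distrib_left mult_ac)
  moreover have "\<dots> = (\<Sum>i<n. \<Sum>j<n. a j i * z j * (x j - x i))"
    by (rule sum.swap)
  moreover have "\<dots> = - (\<Sum>i<n. \<Sum>j<n. a i j * z j * (x i - x j))"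
    by (simp add: sum_negf[symmetric] assms[of _ _] algebra_simps)
  ultimately have "2 * (\<Sum>i<n. z i * laplacian n a x i) = 2 * dirichlet n a z x"
    by (simp add: dirichlet_def algebra_simps sum_subtractf sum.distrib)
  then show ?thesis by simp
qed

text \<open>Summation by parts against the constant 1. It removes the mean term of
  \<open>rhs\<phi>\<close> from the energy balance.\<close>

lemma sum_laplacian:
  assumes "\<And>i j. a i j = a j i"
  shows "(\<Sum>i<n. laplacian n a x i) = 0"
  using sum_mult_laplacian[where a = a and z = "\<lambda>_. 1" and x = x and n = n, OF assms]
  by (simp add: dirichlet_def)

text \<open>The variance identity: for \<open>x\<close> with sum zero, the pairwise differences
  determine the norm.\<close>

lemma sum_sum_diff_squared:
  fixes x :: "nat \<Rightarrow> real"
  shows "(\<Sum>i<n. \<Sum>j<n. (x i - x j)\<^sup>2) = 2 * n * (\<Sum>i<n. (x i)\<^sup>2) - 2 * (\<Sum>i<n. x i)\<^sup>2"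
proof -
  have "(\<Sum>i<n. x i)\<^sup>2 = (\<Sum>i<n. \<Sum>j<n. x i * x j)"
    by (simp add: power2_eq_square sum_product)
  then show ?thesis
    by (simp add: power2_diff sum.distrib sum_subtractf sum_distrib_left mult_ac)
qed

text \<open>Cauchy-Schwarz on the inner sum, then the variance identity without its negative term.
  This boundedness lets Laplacian terms be absorbed after Young's inequality.\<close>

lemma sum_laplacian_squared_le:
  obtains c where "c > 0" "\<And>x. (\<Sum>i<n. (laplacian n a x i)\<^sup>2) \<le> c * (\<Sum>i<n. (x i)\<^sup>2)"
proof -
  obtain d where d: "d > 0" "\<And>p. p \<in> {..<n} \<times> {..<n} \<Longrightarrow> (\<lambda>(i, j). (a i j)\<^sup>2) p \<le> d"
    using finite_pos_upper_bound[of "{..<n} \<times> {..<n}"] by blast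
  show thesis
  proof
    \<comment> \<open>The summand 1 keeps the constant positive for \<open>n = 0\<close>.\<close>
    show "2 * n * n * d + 1 > 0"
      using d(1) by (simp add: add_nonneg_pos)
    fix x :: "nat \<Rightarrow> real"
    have "(\<Sum>i<n. (laplacian n a x i)\<^sup>2) \<le> (\<Sum>i<n. n * (\<Sum>j<n. d * (x i - x j)\<^sup>2))"
    proof (rule sum_mono)
      fix i assume i: "i \<in> {..<n}"
      have "(laplacian n a x i)\<^sup>2 \<le> n * (\<Sum>j<n. (a i j * (x i - x j))\<^sup>2)"
        unfolding laplacian_def using sum_squared_le_sum_of_squares[where I = "{..<n}"]
        by (simp add: mult.commute)
      also have "\<dots> \<le> n * (\<Sum>j<n. d * (x i - x j)\<^sup>2)"
        using d(2)[of "(i, _)"] i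
        by (intro mult_left_mono sum_mono) (auto simp: power_mult_distrib intro!: mult_right_mono)
      finally show "(laplacian n a x i)\<^sup>2 \<le> n * (\<Sum>j<n. d * (x i - x j)\<^sup>2)" .
    qed
    also have "\<dots> = n * d * (\<Sum>i<n. \<Sum>j<n. (x i - x j)\<^sup>2)"
      by (simp add: sum_distrib_left mult_ac)
    also have "\<dots> \<le> n * d * (2 * n * (\<Sum>i<n. (x i)\<^sup>2))"
      unfolding sum_sum_diff_squared using d(1) by (intro mult_left_mono) auto
    also have "\<dots> \<le> (2 * n * n * d + 1) * (\<Sum>i<n. (x i)\<^sup>2)"
      by (simp add: algebra_simps sum_nonneg)
    finally show "(\<Sum>i<n. (laplacian n a x i)\<^sup>2) \<le> (2 * n * n * d + 1) * (\<Sum>i<n. (x i)\<^sup>2)" .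
  qed
qed

lemma dirichlet_nonneg:
  assumes "\<And>i j. a i j \<ge> 0"
  shows "dirichlet n a x x \<ge> 0"
  unfolding dirichlet_def by (auto intro!: sum_nonneg simp: assms mult.assoc)

text \<open>One nonnegative term is at most the whole double sum, which is twice the form. This is a
  single edge of the path argument below.\<close>

lemma weighted_diff_squared_le_dirichlet:
  assumes "\<And>i j. a i j = a j i" "\<And>i j. a i j \<ge> 0" "i < n" "j < n"
  shows "a i j * (x i - x j)\<^sup>2 \<le> 2 * dirichlet n a x x"
proof -
  have nonneg: "0 \<le> a i j * (x i - x j) * (x i - x j)" for i j
    using assms(2) by (simp add: mult.assoc)
  have "a i j * (x i - x j) * (x i - x j) \<le> (\<Sum>j<n. a i j * (x i - x j) * (x i - x j))"
    using assms(4) nonneg by (intro member_le_sum[of j]) auto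
  also have "\<dots> \<le> (\<Sum>i<n. \<Sum>j<n. a i j * (x i - x j) * (x i - x j))"
    using assms(3) nonneg
    by (intro member_le_sum[of i _ "\<lambda>i. \<Sum>j<n. a i j * (x i - x j) * (x i - x j)"])
      (auto intro: sum_nonneg)
  finally show ?thesis
    by (simp add: dirichlet_def power2_eq_square mult.assoc)
qed

text \<open>The constant is accumulated along a path from \<open>i\<close> to \<open>j\<close>.\<close>

lemma diff_squared_le_dirichlet:
  assumes a: "\<And>i j. a i j = a j i" "\<And>i j. a i j \<ge> 0"
    and "(i, j) \<in> {(i, j). i < n \<and> j < n \<and> a i j > 0}\<^sup>*"
  shows "\<exists>c\<ge>0. \<forall>x. (x i - x j)\<^sup>2 \<le> c * dirichlet n a x x"
  using assms(3)
proof (induction rule: rtrancl_induct)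
  case base
  then show ?case by (intro exI[of _ 0]) auto
next
  case (step j k)
  then obtain c where c: "c \<ge> 0" "\<And>x. (x i - x j)\<^sup>2 \<le> c * dirichlet n a x x"
    by blast
  from step have jk: "j < n" "k < n" "a j k > 0" by auto
  have "(x i - x k)\<^sup>2 \<le> (2 * c + 4 / a j k) * dirichlet n a x x" for x
  proof -
    \<comment> \<open>With \<open>p = x i - x j\<close> and \<open>q = x j - x k\<close>, the gap
      between the two sides is the square of \<open>p - q\<close>.\<close>
    have "(x i - x k)\<^sup>2 \<le> 2 * (x i - x j)\<^sup>2 + 2 * (x j - x k)\<^sup>2"
      using sum_squares_ge_zero[of "x i - 2 * x j + x k" 0]
      by (simp add: power2_eq_square algebra_simps)
    moreover have "(x j - x k)\<^sup>2 \<le> 2 / a j k * dirichlet n a x x"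
      using weighted_diff_squared_le_dirichlet[OF a jk(1,2), where x = x] jk(3)
      by (simp add: field_simps)
    ultimately show ?thesis
      using c(2)[of x] by (simp add: algebra_simps)
  qed
  then show ?case
    using c(1) jk(3) by (intro exI[of _ "2 * c + 4 / a j k"]) auto
qed

text \<open>The pairwise path estimates are summed over all pairs; since \<open>x\<close> has sum
  zero, the variance identity turns the left side into a multiple of the norm. No sharp constant is
  sought.\<close>

lemma poincare_inequality:
  assumes a: "\<And>i j. a i j = a j i" "\<And>i j. a i j \<ge> 0"
    and conn: "\<And>i j. i < n \<Longrightarrow> j < n \<Longrightarrow> (i, j) \<in> {(i, j). i < n \<and> j < n \<and> a i j > 0}\<^sup>*"
  obtains c where "c > 0"
    "\<And>x. (\<Sum>i<n. x i) = 0 \<Longrightarrow> (\<Sum>i<n. (x i)\<^sup>2) \<le> c * dirichlet n a x x"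
proof -
  have "\<exists>c. \<forall>i j. i < n \<longrightarrow> j < n \<longrightarrow> c i j \<ge> 0 \<and> (\<forall>x. (x i - x j)\<^sup>2 \<le> c i j * dirichlet n a x x)"
    using diff_squared_le_dirichlet[OF a conn] by metis
  then obtain c where c: "\<And>i j x. i < n \<Longrightarrow> j < n \<Longrightarrow> (x i - x j)\<^sup>2 \<le> c i j * dirichlet n a x x"
    and c0: "\<And>i j. i < n \<Longrightarrow> j < n \<Longrightarrow> c i j \<ge> 0"
    by blast
  \<comment> \<open>The summand 1 makes \<open>K\<close> positive even if all \<open>c i j\<close>
    vanish.\<close>
  define K where "K = (\<Sum>i<n. \<Sum>j<n. c i j) + 1"
  have K: "K > 0"
    unfolding K_def using c0 by (auto intro!: add_nonneg_pos sum_nonneg)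
  show thesis
  proof (rule that[OF K])
    fix x :: "nat \<Rightarrow> real" assume x: "(\<Sum>i<n. x i) = 0"
    have "2 * n * (\<Sum>i<n. (x i)\<^sup>2) = (\<Sum>i<n. \<Sum>j<n. (x i - x j)\<^sup>2)"
      by (simp add: sum_sum_diff_squared x)
    also have "\<dots> \<le> (\<Sum>i<n. \<Sum>j<n. c i j * dirichlet n a x x)"
      using c by (intro sum_mono) auto
    also have "\<dots> \<le> K * dirichlet n a x x"
      by (simp add: K_def sum_distrib_right[symmetric] algebra_simps dirichlet_nonneg a(2))
    finally have *: "2 * n * (\<Sum>i<n. (x i)\<^sup>2) \<le> K * dirichlet n a x x" .
    show "(\<Sum>i<n. (x i)\<^sup>2) \<le> K * dirichlet n a x x"
    proof (cases "n = 0")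
      case True
      then show ?thesis using * by simp
    next
      case False
      then have "1 * (\<Sum>i<n. (x i)\<^sup>2) \<le> 2 * n * (\<Sum>i<n. (x i)\<^sup>2)"
        by (intro mult_right_mono sum_nonneg) auto
      then show ?thesis using * by simp
    qed
  qed
qed

text \<open>Cancellation of the indefinite cross term by completing the square.\<close>

lemma dirichlet_quadratic_lower_bound:
  assumes "\<And>i j. a i j \<ge> 0" "V > 0"
  shows "k * (\<gamma> - k / (4 * V)) * dirichlet n a y y
    \<le> V * dirichlet n a v v - k * dirichlet n a v y + \<gamma> * k * dirichlet n a y y"
proof -
  \<comment> \<open>The shift \<open>k / (2 * V)\<close> is the one that reproduces the cross term;
    the square then leaves \<open>k * k / (4 * V)\<close> times the form of \<open>y\<close>, whence
    the threshold for \<gamma>.\<close>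
  have "0 \<le> V * (\<Sum>i<n. \<Sum>j<n. a i j * ((v i - v j) - k / (2 * V) * (y i - y j))\<^sup>2) / 2"
    using assms by (intro divide_nonneg_nonneg mult_nonneg_nonneg sum_nonneg) auto
  also have "\<dots> = V * dirichlet n a v v - k * dirichlet n a v y + k\<^sup>2 / (4 * V) * dirichlet n a y y"
  proof -
    have "V * (a i j * ((v i - v j) - k / (2 * V) * (y i - y j))\<^sup>2) =
        V * (a i j * (v i - v j) * (v i - v j)) - k * (a i j * (v i - v j) * (y i - y j))
        + k\<^sup>2 / (4 * V) * (a i j * (y i - y j) * (y i - y j))" for i j
    proof -
      have "V * (A * (p - k / (2 * V) * q)\<^sup>2) = V * (A * p * p) - k * (A * p * q)
          + k\<^sup>2 / (4 * V) * (A * q * q)" for A p q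
        using assms(2) by (simp add: field_simps power2_eq_square)
      then show ?thesis .
    qed
    then show ?thesis
      unfolding dirichlet_def sum_distrib_left
      by (simp add: sum_distrib_left sum.distrib sum_subtractf add_divide_distrib diff_divide_distrib)
  qed
  finally show ?thesis
    by (simp add: algebra_simps power2_eq_square)
qed

section \<open>A strict Lyapunov function\<close>

text \<open>Here \<open>a\<close> stands for the line conductances and \<open>b\<close> for the
  communication weights of \<eta>. The Laplacian of \<phi> appears only as \<open>k\<phi>\<close>
  times that of \<open>a\<close>. Connectedness is phrased as reachability, as in the Poincare
  inequality.\<close>

locale hvdc =
  fixes n :: nat
    and a b :: "nat \<Rightarrow> nat \<Rightarrow> real"
    and m C k\<omega> kV kD kI :: "nat \<Rightarrow> real"
    and Vnom \<gamma> k\<phi> :: real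
  assumes a_sym: "\<And>i j. a i j = a j i" and a_nonneg: "\<And>i j. a i j \<ge> 0"
    and b_sym: "\<And>i j. b i j = b j i" and b_nonneg: "\<And>i j. b i j \<ge> 0"
    and a_connected: "\<And>i j. i < n \<Longrightarrow> j < n \<Longrightarrow> (i, j) \<in> {(i, j). i < n \<and> j < n \<and> a i j > 0}\<^sup>*"
    and m_pos: "\<And>i. i < n \<Longrightarrow> m i > 0" and C_pos: "\<And>i. i < n \<Longrightarrow> C i > 0"
    and k\<omega>_pos: "\<And>i. i < n \<Longrightarrow> k\<omega> i > 0" and kV_pos: "\<And>i. i < n \<Longrightarrow> kV i > 0"
    and kD_pos: "\<And>i. i < n \<Longrightarrow> kD i > 0" and kI_pos: "\<And>i. i < n \<Longrightarrow> kI i > 0"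
    and Vnom_pos: "Vnom > 0" and k\<phi>_pos: "k\<phi> > 0" and \<gamma>_large: "\<gamma> > k\<phi> / (4 * Vnom)"
begin

text \<open>Scaling the frequency equation by this ratio turns its coupling to \<open>v\<close> into
  \<open>k\<omega>\<close> and its coupling to \<open>e\<close> into \<open>- kI\<close>, matching
  the opposite couplings in the other equations.\<close>

definition u :: "nat \<Rightarrow> real" where
  "u i = k\<omega> i / kV i"

text \<open>The vector field in the coordinates \<open>w = \<omega>\<close>, \<open>v = V\<close>, \<open>e = \<eta>\<close> and \<open>y = S \<phi>\<close>.\<close>

definition rhs\<omega> where
  "rhs\<omega> w v e y i = (- (kD i + k\<omega> i) * w i + kV i * v i - kV i / k\<omega> i * kI i * e i
      - k\<phi> * laplacian n a y i) / m i"

definition rhsV where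
  "rhsV w v y i = (k\<omega> i * w i / Vnom - (laplacian n a v i + kV i * v i / Vnom)
      + k\<phi> / Vnom * laplacian n a y i) / C i"

definition rhs\<eta> where
  "rhs\<eta> w e i = kI i * w i - laplacian n b e i"

text \<open>The subtracted mean comes from \<open>S * transpose_mat S\<close>, the projection
  orthogonal to the constants.\<close>

definition rhs\<phi> where
  "rhs\<phi> w y i = u i * w i - (\<Sum>j<n. u j * w j) / n - \<gamma> * y i"

definition energy where
  "energy w v e y = ((\<Sum>i<n. u i * m i * (w i)\<^sup>2) + Vnom * (\<Sum>i<n. C i * (v i)\<^sup>2)
      + (\<Sum>i<n. (e i)\<^sup>2) + k\<phi> * dirichlet n a y y) / 2"

definition dissipation where
  "dissipation w v e y = (\<Sum>i<n. u i * kD i * (w i)\<^sup>2) + (\<Sum>i<n. (k\<omega> i * w i - kV i * v i)\<^sup>2 / kV i)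
      + (Vnom * dirichlet n a v v - k\<phi> * dirichlet n a v y + \<gamma> * k\<phi> * dirichlet n a y y)
      + dirichlet n b e e"

text \<open>The part of the state that the dissipation controls by itself; \<eta> is therefore left
  out.\<close>

definition sqsum where
  "sqsum w v y = (\<Sum>i<n. (w i)\<^sup>2) + (\<Sum>i<n. (v i)\<^sup>2) + (\<Sum>i<n. (y i)\<^sup>2)"

lemma u_pos: "i < n \<Longrightarrow> u i > 0"
  by (simp add: u_def k\<omega>_pos kV_pos)

text \<open>The left side is the gradient of \<open>energy\<close> paired with the vector field. The
  weights make the products of \<open>w\<close> with \<open>e\<close> and of
  \<open>u i * w i\<close> with the Laplacian of \<open>y\<close> cancel, while the two products of
  \<open>w\<close> and \<open>v\<close> complete a square.\<close>

lemma energy_derivative: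
  "(\<Sum>i<n. u i * m i * w i * rhs\<omega> w v e y i) + Vnom * (\<Sum>i<n. C i * v i * rhsV w v y i)
     + (\<Sum>i<n. e i * rhs\<eta> w e i) + k\<phi> * dirichlet n a y (rhs\<phi> w y)
   = - dissipation w v e y"
proof -
  define A where "A = (\<Sum>j<n. u j * w j) / n"
  \<comment> \<open>Moving the Laplacian onto \<open>y\<close> reduces everything to a single sum,
    compared index by index.\<close>
  have "dirichlet n a y (rhs\<phi> w y) = (\<Sum>i<n. rhs\<phi> w y i * laplacian n a y i)"
    unfolding sum_mult_laplacian[OF a_sym] dirichlet_def by (simp add: mult_ac)
  then have "(\<Sum>i<n. u i * m i * w i * rhs\<omega> w v e y i) + Vnom * (\<Sum>i<n. C i * v i * rhsV w v y i)
     + (\<Sum>i<n. e i * rhs\<eta> w e i) + k\<phi> * dirichlet n a y (rhs\<phi> w y)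
     = (\<Sum>i<n. u i * m i * w i * rhs\<omega> w v e y i + Vnom * (C i * v i * rhsV w v y i)
        + e i * rhs\<eta> w e i + k\<phi> * (rhs\<phi> w y i * laplacian n a y i))"
    by (simp add: sum.distrib sum_distrib_left)
  \<comment> \<open>The mean \<open>A\<close> survives only as a factor of the Laplacian of
    \<open>y\<close>, whose sum is zero.\<close>
  also have "\<dots> = (\<Sum>i<n. - (u i * kD i * (w i)\<^sup>2) - (k\<omega> i * w i - kV i * v i)\<^sup>2 / kV i
      - Vnom * (v i * laplacian n a v i) + k\<phi> * (v i * laplacian n a y i)
      - \<gamma> * k\<phi> * (y i * laplacian n a y i) - e i * laplacian n b e i
      - k\<phi> * A * laplacian n a y i)"
  proof (rule sum.cong[OF refl])
    fix i assume "i \<in> {..<n}"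
    then have pos: "m i > 0" "C i > 0" "k\<omega> i > 0" "kV i > 0"
      by (auto simp: m_pos C_pos k\<omega>_pos kV_pos)
    have 1: "u i * m i * w i * rhs\<omega> w v e y i = - (u i * kD i * (w i)\<^sup>2) - (k\<omega> i)\<^sup>2 / kV i * (w i)\<^sup>2
        + k\<omega> i * w i * v i - kI i * w i * e i - k\<phi> * (u i * w i * laplacian n a y i)"
      using pos unfolding rhs\<omega>_def u_def by (simp add: field_simps power2_eq_square)
    have 2: "Vnom * (C i * v i * rhsV w v y i) = k\<omega> i * w i * v i - Vnom * (v i * laplacian n a v i)
        - kV i * (v i)\<^sup>2 + k\<phi> * (v i * laplacian n a y i)"
      using pos Vnom_pos unfolding rhsV_def by (simp add: field_simps power2_eq_square)
    have 3: "k\<phi> * (rhs\<phi> w y i * laplacian n a y i) = k\<phi> * (u i * w i * laplacian n a y i)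
        - k\<phi> * A * laplacian n a y i - \<gamma> * k\<phi> * (y i * laplacian n a y i)"
      unfolding rhs\<phi>_def A_def[symmetric] by (simp add: algebra_simps)
    have 4: "(k\<omega> i * w i - kV i * v i)\<^sup>2 / kV i = (k\<omega> i)\<^sup>2 / kV i * (w i)\<^sup>2 - 2 * (k\<omega> i * w i * v i) + kV i * (v i)\<^sup>2"
      using pos by (simp add: field_simps power2_eq_square)
    show "u i * m i * w i * rhs\<omega> w v e y i + Vnom * (C i * v i * rhsV w v y i)
        + e i * rhs\<eta> w e i + k\<phi> * (rhs\<phi> w y i * laplacian n a y i) =
        - (u i * kD i * (w i)\<^sup>2) - (k\<omega> i * w i - kV i * v i)\<^sup>2 / kV i
      - Vnom * (v i * laplacian n a v i) + k\<phi> * (v i * laplacian n a y i)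
      - \<gamma> * k\<phi> * (y i * laplacian n a y i) - e i * laplacian n b e i
      - k\<phi> * A * laplacian n a y i"
      unfolding 1 2 3 4 rhs\<eta>_def by (simp add: algebra_simps)
  qed
  also have "\<dots> = - dissipation w v e y"
    unfolding dissipation_def sum_mult_laplacian[OF a_sym, symmetric]
      sum_mult_laplacian[OF b_sym, symmetric]
    by (simp add: sum.distrib sum_subtractf sum_negf sum_distrib_left[symmetric]
        sum_laplacian[OF a_sym])
  finally show ?thesis .
qed

text \<open>For each node, the form in \<open>w\<close> and \<open>v\<close> is positive definite:
  damping gives \<open>w\<close>, then the square gives \<open>v\<close>. Completing the square and
  the Poincare inequality give \<open>y\<close>; the form of \<open>e\<close> is merely
  nonnegative.\<close>

lemma dissipation_coercive:
  obtains c where "c > 0"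
    "\<And>w v e y. (\<Sum>i<n. y i) = 0 \<Longrightarrow> c * sqsum w v y \<le> dissipation w v e y"
proof -
  obtain K where K: "K > 0" "\<And>y. (\<Sum>i<n. y i) = 0 \<Longrightarrow> (\<Sum>i<n. (y i)\<^sup>2) \<le> K * dirichlet n a y y"
    using poincare_inequality[OF a_sym a_nonneg a_connected] by blast
  \<comment> \<open>The coefficient left by \<open>dirichlet_quadratic_lower_bound\<close>, positive
    by the assumption on \<gamma>.\<close>
  define \<delta> where "\<delta> = k\<phi> * (\<gamma> - k\<phi> / (4 * Vnom))"
  have \<delta>: "\<delta> > 0"
    using \<gamma>_large k\<phi>_pos by (simp add: \<delta>_def)
  have "\<exists>c>0. \<forall>x z. c * (x\<^sup>2 + z\<^sup>2) \<le> u i * kD i * x\<^sup>2 + (k\<omega> i * x - kV i * z)\<^sup>2 / kV i"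
    if i: "i < n" for i
  proof -
    define r where "r = kV i"
    define s where "s = u i * kD i"
    define t where "t = k\<omega> i"
    have pos: "r > 0" "s > 0" "t > 0"
      using i by (auto simp: r_def s_def t_def kV_pos u_pos kD_pos k\<omega>_pos)
    \<comment> \<open>So small that recovering the square of \<open>z\<close> from that of
      \<open>t * x - r * z\<close> costs at most \<open>s / 4\<close> of the damping of
      \<open>x\<close>.\<close>
    obtain \<mu> where \<mu>: "\<mu> > 0" "\<mu> \<le> 1" "2 * t\<^sup>2 * \<mu> \<le> s / 2 * r"
    proof
      show "min 1 (s * r / (4 * t\<^sup>2)) > 0" using pos by simp
      show "2 * t\<^sup>2 * min 1 (s * r / (4 * t\<^sup>2)) \<le> s / 2 * r"
        using pos by (auto simp: min_def field_simps)
    qed simp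
    have "min (s / 2) (\<mu> * r / 2) * (x\<^sup>2 + z\<^sup>2) \<le> s * x\<^sup>2 + (t * x - r * z)\<^sup>2 / r" for x z
    proof -
      have "(r * z)\<^sup>2 \<le> 2 * (t * x - r * z)\<^sup>2 + 2 * t\<^sup>2 * x\<^sup>2"
        using sum_squares_ge_zero[of "2 * t * x - r * z" 0]
        by (simp add: power2_eq_square algebra_simps)
      then have "\<mu> / (2 * r) * (r * z)\<^sup>2 \<le> \<mu> / (2 * r) * (2 * (t * x - r * z)\<^sup>2 + 2 * t\<^sup>2 * x\<^sup>2)"
        using pos \<mu> by (intro mult_left_mono) auto
      also have "\<dots> = \<mu> * ((t * x - r * z)\<^sup>2 / r) + 2 * t\<^sup>2 * \<mu> / (2 * r) * x\<^sup>2"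
        using pos by (simp add: field_simps)
      also have "\<dots> \<le> 1 * ((t * x - r * z)\<^sup>2 / r) + s / 2 * r / (2 * r) * x\<^sup>2"
        using pos \<mu> by (intro add_mono mult_right_mono divide_right_mono) auto
      finally have *: "\<mu> * r / 2 * z\<^sup>2 \<le> (t * x - r * z)\<^sup>2 / r + s / 4 * x\<^sup>2"
        using pos by (simp add: field_simps power2_eq_square)
      have "min (s / 2) (\<mu> * r / 2) * x\<^sup>2 \<le> s / 2 * x\<^sup>2" "min (s / 2) (\<mu> * r / 2) * z\<^sup>2 \<le> \<mu> * r / 2 * z\<^sup>2"
        by (rule mult_right_mono; simp)+
      moreover have "s / 4 * x\<^sup>2 \<ge> 0"
        using pos by simp
      ultimately show ?thesis using * by (simp add: distrib_left)
    qed
    moreover have "min (s / 2) (\<mu> * r / 2) > 0" using pos \<mu> by simp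
    ultimately show ?thesis unfolding r_def s_def t_def by blast
  qed
  then obtain f where f: "\<And>i. i < n \<Longrightarrow> f i > 0"
      "\<And>i x z. i < n \<Longrightarrow> f i * (x\<^sup>2 + z\<^sup>2) \<le> u i * kD i * x\<^sup>2 + (k\<omega> i * x - kV i * z)\<^sup>2 / kV i"
    by metis
  obtain c where c: "c > 0" "\<And>i. i \<in> {..<n} \<Longrightarrow> c \<le> f i"
    using finite_pos_lower_bound[of "{..<n}" f] f(1) by auto
  show thesis
  proof (rule that[of "min c (\<delta> / K)"])
    show "min c (\<delta> / K) > 0" using c \<delta> K by simp
    fix w v e y :: "nat \<Rightarrow> real" assume y: "(\<Sum>i<n. y i) = 0"
    have "c * ((\<Sum>i<n. (w i)\<^sup>2) + (\<Sum>i<n. (v i)\<^sup>2)) = (\<Sum>i<n. c * ((w i)\<^sup>2 + (v i)\<^sup>2))"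
      by (simp add: sum.distrib sum_distrib_left distrib_left)
    also have "\<dots> \<le> (\<Sum>i<n. u i * kD i * (w i)\<^sup>2 + (k\<omega> i * w i - kV i * v i)\<^sup>2 / kV i)"
    proof (rule sum_mono)
      fix i assume i: "i \<in> {..<n}"
      have "c * ((w i)\<^sup>2 + (v i)\<^sup>2) \<le> f i * ((w i)\<^sup>2 + (v i)\<^sup>2)"
        using c(2)[OF i] by (intro mult_right_mono) auto
      also have "\<dots> \<le> u i * kD i * (w i)\<^sup>2 + (k\<omega> i * w i - kV i * v i)\<^sup>2 / kV i"
        using f(2) i by auto
      finally show "c * ((w i)\<^sup>2 + (v i)\<^sup>2) \<le> u i * kD i * (w i)\<^sup>2 + (k\<omega> i * w i - kV i * v i)\<^sup>2 / kV i" .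
    qed
    finally have 1: "c * ((\<Sum>i<n. (w i)\<^sup>2) + (\<Sum>i<n. (v i)\<^sup>2))
        \<le> (\<Sum>i<n. u i * kD i * (w i)\<^sup>2) + (\<Sum>i<n. (k\<omega> i * w i - kV i * v i)\<^sup>2 / kV i)"
      by (simp add: sum.distrib)
    have "\<delta> / K * (\<Sum>i<n. (y i)\<^sup>2) \<le> \<delta> / K * (K * dirichlet n a y y)"
      using K(2)[OF y] \<delta> K(1) by (intro mult_left_mono) auto
    also have "\<dots> \<le> Vnom * dirichlet n a v v - k\<phi> * dirichlet n a v y + \<gamma> * k\<phi> * dirichlet n a y y"
      using dirichlet_quadratic_lower_bound[where a = a and k = k\<phi>, OF a_nonneg Vnom_pos] K(1)
      by (simp add: \<delta>_def mult.assoc)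
    finally have 2: "\<delta> / K * (\<Sum>i<n. (y i)\<^sup>2) \<le> \<dots>" .
    have "min c (\<delta> / K) * ((\<Sum>i<n. (w i)\<^sup>2) + (\<Sum>i<n. (v i)\<^sup>2)) \<le> c * ((\<Sum>i<n. (w i)\<^sup>2) + (\<Sum>i<n. (v i)\<^sup>2))"
      "min c (\<delta> / K) * (\<Sum>i<n. (y i)\<^sup>2) \<le> \<delta> / K * (\<Sum>i<n. (y i)\<^sup>2)"
      by (rule mult_right_mono; simp add: sum_nonneg)+
    with 1 2 dirichlet_nonneg[where a = b and n = n and x = e, OF b_nonneg]
    show "min c (\<delta> / K) * sqsum w v y \<le> dissipation w v e y"
      unfolding sqsum_def dissipation_def by (simp add: distrib_left)
  qed
qed

text \<open>With the weight that \<omega> has in the energy, the coupling of \<eta> into \<omega>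
  contributes exactly \<open>- kI i\<close> times the square of \<open>e i\<close> to the
  derivative.\<close>

definition cross where
  "cross w e = (\<Sum>i<n. u i * m i * w i * e i)"

definition cross_derivative where
  "cross_derivative w v e y = (\<Sum>i<n. u i * m i * (rhs\<omega> w v e y i * e i + w i * rhs\<eta> w e i))"

text \<open>
  The energy does not dissipate \<open>\<eta>\<close> along constant vectors. Differentiating the product of
  \<open>\<omega>\<close> and \<open>\<eta>\<close> produces the missing negative term, from the coupling of \<open>\<eta>\<close> into \<open>\<omega>\<close>.
\<close>

lemma cross_derivative_le:
  obtains \<kappa> c where "\<kappa> > 0" "c > 0"
    "\<And>w v e y. cross_derivative w v e y \<le> - \<kappa> * (\<Sum>i<n. (e i)\<^sup>2) + c * sqsum w v y"
proof -
  obtain \<kappa> where \<kappa>: "\<kappa> > 0" "\<And>i. i \<in> {..<n} \<Longrightarrow> \<kappa> \<le> kI i"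
    using finite_pos_lower_bound[of "{..<n}" kI] kI_pos by auto
  obtain \<Lambda> where \<Lambda>: "\<Lambda> > 0" "\<And>x. (\<Sum>i<n. (laplacian n a x i)\<^sup>2) \<le> \<Lambda> * (\<Sum>i<n. (x i)\<^sup>2)"
    using sum_laplacian_squared_le by blast
  obtain \<Lambda>' where \<Lambda>': "\<Lambda>' > 0" "\<And>x. (\<Sum>i<n. (laplacian n b x i)\<^sup>2) \<le> \<Lambda>' * (\<Sum>i<n. (x i)\<^sup>2)"
    using sum_laplacian_squared_le by blast
  \<comment> \<open>Chosen so that the Laplacian of \<open>e\<close> costs only
    \<open>\<kappa> / 8\<close>, once its norm is bounded by that of \<open>e\<close>.\<close>
  define \<theta> where "\<theta> = \<kappa> / (8 * \<Lambda>')"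
  have \<theta>: "\<theta> > 0" "\<theta> * \<Lambda>' = \<kappa> / 8"
    using \<kappa> \<Lambda>' by (auto simp: \<theta>_def)
  \<comment> \<open>The coefficients left by Young's inequality with parameter
    \<open>\<kappa> / 8\<close>, whose denominator \<open>4 * (\<kappa> / 8)\<close> gives the
    factor \<open>2 / \<kappa>\<close>.\<close>
  define cw where "cw i = u i * m i * kI i + (u i * (kD i + k\<omega> i))\<^sup>2 * 2 / \<kappa> + (u i * m i)\<^sup>2 / (4 * \<theta>)" for i
  define cv where "cv i = (u i * kV i)\<^sup>2 * 2 / \<kappa>" for i
  define cy where "cy i = (u i * k\<phi>)\<^sup>2 * 2 / \<kappa>" for i
  obtain Uw where Uw: "Uw > 0" "\<And>i. i \<in> {..<n} \<Longrightarrow> cw i \<le> Uw"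
    using finite_pos_upper_bound[of "{..<n}" cw] by auto
  obtain Uv where Uv: "Uv > 0" "\<And>i. i \<in> {..<n} \<Longrightarrow> cv i \<le> Uv"
    using finite_pos_upper_bound[of "{..<n}" cv] by auto
  obtain Uy where Uy: "Uy > 0" "\<And>i. i \<in> {..<n} \<Longrightarrow> cy i \<le> Uy"
    using finite_pos_upper_bound[of "{..<n}" cy] by auto
  define c where "c = Uw + Uv + Uy * \<Lambda>"
  show thesis
  proof (rule that[of "\<kappa> / 2" c])
    show "\<kappa> / 2 > 0" using \<kappa> by simp
    show "c > 0" using Uw(1) Uv(1) mult_pos_pos[OF Uy(1) \<Lambda>(1)] by (simp add: c_def)
    fix w v e y :: "nat \<Rightarrow> real"
    have "cross_derivative w v e y \<le> (\<Sum>i<n. - (5 * \<kappa> / 8) * (e i)\<^sup>2 + Uw * (w i)\<^sup>2 + Uv * (v i)\<^sup>2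
        + Uy * (laplacian n a y i)\<^sup>2 + \<theta> * (laplacian n b e i)\<^sup>2)"
      unfolding cross_derivative_def
    proof (rule sum_mono)
      fix i assume i: "i \<in> {..<n}"
      then have pos: "m i > 0" "k\<omega> i > 0" "kV i > 0"
        by (auto simp: m_pos k\<omega>_pos kV_pos)
      define s where "s = u i * (kD i + k\<omega> i)"
      have "u i * m i * (rhs\<omega> w v e y i * e i + w i * rhs\<eta> w e i)
          = u i * m i * kI i * (w i)\<^sup>2 - kI i * (e i)\<^sup>2
          + e i * (- s * w i) + e i * (u i * kV i * v i)
          + e i * (- (u i * k\<phi>) * laplacian n a y i)
          + laplacian n b e i * (- (u i * m i) * w i)"
        using pos unfolding rhs\<omega>_def rhs\<eta>_def s_def u_def by (simp add: field_simps power2_eq_square)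
      \<comment> \<open>Young's inequality on the four mixed products. Three of them each spend
        \<open>\<kappa> / 8\<close> of the negative term in \<open>e\<close>, leaving
        \<open>5 * \<kappa> / 8\<close>; the fourth puts \<theta> on the Laplacian of
        \<open>e\<close>. The final margin is \<open>\<kappa> / 2\<close>.\<close>
      also have "\<dots> \<le> u i * m i * kI i * (w i)\<^sup>2 - \<kappa> * (e i)\<^sup>2
          + (\<kappa> / 8 * (e i)\<^sup>2 + (- s * w i)\<^sup>2 / (4 * (\<kappa> / 8)))
          + (\<kappa> / 8 * (e i)\<^sup>2 + (u i * kV i * v i)\<^sup>2 / (4 * (\<kappa> / 8)))
          + (\<kappa> / 8 * (e i)\<^sup>2 + (- (u i * k\<phi>) * laplacian n a y i)\<^sup>2 / (4 * (\<kappa> / 8)))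
          + (\<theta> * (laplacian n b e i)\<^sup>2 + (- (u i * m i) * w i)\<^sup>2 / (4 * \<theta>))"
        using \<kappa> \<theta> i by (intro add_mono diff_mono mult_le_young order_refl mult_right_mono) auto
      also have "\<dots> = - (5 * \<kappa> / 8) * (e i)\<^sup>2 + cw i * (w i)\<^sup>2 + cv i * (v i)\<^sup>2
        + cy i * (laplacian n a y i)\<^sup>2 + \<theta> * (laplacian n b e i)\<^sup>2"
        unfolding cw_def cv_def cy_def s_def[symmetric]
        by (simp add: power_mult_distrib add_divide_distrib algebra_simps)
      also have "\<dots> \<le> - (5 * \<kappa> / 8) * (e i)\<^sup>2 + Uw * (w i)\<^sup>2 + Uv * (v i)\<^sup>2
        + Uy * (laplacian n a y i)\<^sup>2 + \<theta> * (laplacian n b e i)\<^sup>2"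
        using Uw Uv Uy i by (intro add_mono order_refl mult_right_mono) auto
      finally show "u i * m i * (rhs\<omega> w v e y i * e i + w i * rhs\<eta> w e i) \<le> \<dots>" .
    qed
    also have "\<dots> = - (5 * \<kappa> / 8) * (\<Sum>i<n. (e i)\<^sup>2) + Uw * (\<Sum>i<n. (w i)\<^sup>2) + Uv * (\<Sum>i<n. (v i)\<^sup>2)
        + Uy * (\<Sum>i<n. (laplacian n a y i)\<^sup>2) + \<theta> * (\<Sum>i<n. (laplacian n b e i)\<^sup>2)"
      by (simp add: sum.distrib sum_subtractf sum_negf sum_distrib_left)
    also have "\<dots> \<le> - (5 * \<kappa> / 8) * (\<Sum>i<n. (e i)\<^sup>2) + Uw * (\<Sum>i<n. (w i)\<^sup>2) + Uv * (\<Sum>i<n. (v i)\<^sup>2)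
        + Uy * (\<Lambda> * (\<Sum>i<n. (y i)\<^sup>2)) + \<theta> * (\<Lambda>' * (\<Sum>i<n. (e i)\<^sup>2))"
      using \<Lambda>(2) \<Lambda>'(2) Uy(1) \<theta>(1) by (intro add_mono order_refl mult_left_mono) auto
    also have "\<dots> = - (\<kappa> / 2) * (\<Sum>i<n. (e i)\<^sup>2) + Uw * (\<Sum>i<n. (w i)\<^sup>2) + Uv * (\<Sum>i<n. (v i)\<^sup>2)
        + Uy * \<Lambda> * (\<Sum>i<n. (y i)\<^sup>2)"
      unfolding mult.assoc[symmetric] \<theta>(2) by (simp add: algebra_simps)
    also have "\<dots> \<le> - (\<kappa> / 2) * (\<Sum>i<n. (e i)\<^sup>2) + c * (\<Sum>i<n. (w i)\<^sup>2) + c * (\<Sum>i<n. (v i)\<^sup>2)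
        + c * (\<Sum>i<n. (y i)\<^sup>2)"
      using Uw(1) Uv(1) Uy(1) \<Lambda>(1) unfolding c_def
      by (intro add_mono order_refl mult_right_mono sum_nonneg) auto
    finally show "cross_derivative w v e y \<le> - (\<kappa> / 2) * (\<Sum>i<n. (e i)\<^sup>2) + c * sqsum w v y"
      by (simp add: sqsum_def distrib_left)
  qed
qed

text \<open>Only the Dirichlet term is not a weighted sum of squares. From below it needs the
  Poincare inequality, hence the sum-zero condition; from above, boundedness of the
  Laplacian.\<close>

lemma energy_bounds:
  obtains \<alpha> \<beta> where "\<alpha> > 0" "\<beta> > 0"
    "\<And>w v e y. (\<Sum>i<n. y i) = 0 \<Longrightarrow> \<alpha> * (sqsum w v y + (\<Sum>i<n. (e i)\<^sup>2)) \<le> energy w v e y"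
    "\<And>w v e y. energy w v e y \<le> \<beta> * (sqsum w v y + (\<Sum>i<n. (e i)\<^sup>2))"
proof -
  obtain K where K: "K > 0" "\<And>y. (\<Sum>i<n. y i) = 0 \<Longrightarrow> (\<Sum>i<n. (y i)\<^sup>2) \<le> K * dirichlet n a y y"
    using poincare_inequality[OF a_sym a_nonneg a_connected] by blast
  obtain \<Lambda> where \<Lambda>: "\<Lambda> > 0" "\<And>x. (\<Sum>i<n. (laplacian n a x i)\<^sup>2) \<le> \<Lambda> * (\<Sum>i<n. (x i)\<^sup>2)"
    using sum_laplacian_squared_le by blast
  obtain lw where lw: "lw > 0" "\<And>i. i \<in> {..<n} \<Longrightarrow> lw \<le> u i * m i"
    using finite_pos_lower_bound[of "{..<n}" "\<lambda>i. u i * m i"] u_pos m_pos by auto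
  obtain lv where lv: "lv > 0" "\<And>i. i \<in> {..<n} \<Longrightarrow> lv \<le> C i"
    using finite_pos_lower_bound[of "{..<n}" C] C_pos by auto
  obtain uw where uw: "uw > 0" "\<And>i. i \<in> {..<n} \<Longrightarrow> u i * m i \<le> uw"
    using finite_pos_upper_bound[of "{..<n}" "\<lambda>i. u i * m i"] by auto
  obtain uv where uv: "uv > 0" "\<And>i. i \<in> {..<n} \<Longrightarrow> C i \<le> uv"
    using finite_pos_upper_bound[of "{..<n}" C] by auto
  \<comment> \<open>Half the least lower and half the sum of the upper coefficients, since
    \<open>energy\<close> carries a factor 1/2.\<close>
  define \<alpha> where "\<alpha> = min (min lw (Vnom * lv)) (min 1 (k\<phi> / K)) / 2"
  define \<beta> where "\<beta> = (uw + Vnom * uv + 1 + k\<phi> * (1 + \<Lambda>)) / 2"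
  show thesis
  proof (rule that[of \<alpha> \<beta>])
    show "\<alpha> > 0" using lw lv Vnom_pos K k\<phi>_pos by (simp add: \<alpha>_def)
    show "\<beta> > 0" using uw uv Vnom_pos k\<phi>_pos \<Lambda> by (simp add: \<beta>_def add_pos_pos)
    fix w v e y :: "nat \<Rightarrow> real"
    define W where "W = (\<Sum>i<n. (w i)\<^sup>2)"
    define V where "V = (\<Sum>i<n. (v i)\<^sup>2)"
    define E where "E = (\<Sum>i<n. (e i)\<^sup>2)"
    define Y where "Y = (\<Sum>i<n. (y i)\<^sup>2)"
    have nonneg: "W \<ge> 0" "V \<ge> 0" "E \<ge> 0" "Y \<ge> 0"
      by (auto simp: W_def V_def E_def Y_def sum_nonneg)
    have "energy w v e y \<le> (uw * W + Vnom * (uv * V) + E + k\<phi> * ((1 + \<Lambda>) * Y)) / 2"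
    proof -
      have "(\<Sum>i<n. u i * m i * (w i)\<^sup>2) \<le> uw * W"
        unfolding W_def sum_distrib_left using uw by (intro sum_mono mult_right_mono) auto
      moreover have "(\<Sum>i<n. C i * (v i)\<^sup>2) \<le> uv * V"
        unfolding V_def sum_distrib_left using uv by (intro sum_mono mult_right_mono) auto
      moreover have "dirichlet n a y y \<le> (1 + \<Lambda>) * Y"
      proof -
        have "dirichlet n a y y \<le> (\<Sum>i<n. 1 * (y i)\<^sup>2 + (laplacian n a y i)\<^sup>2 / (4 * 1))"
          unfolding sum_mult_laplacian[OF a_sym, symmetric] by (intro sum_mono mult_le_young) simp
        also have "\<dots> \<le> Y + (\<Sum>i<n. (laplacian n a y i)\<^sup>2)"
          by (auto simp: Y_def sum.distrib intro!: sum_mono)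
        also have "\<dots> \<le> (1 + \<Lambda>) * Y" using \<Lambda>(2)[of y] by (simp add: Y_def distrib_right)
        finally show ?thesis .
      qed
      ultimately show ?thesis
        unfolding energy_def E_def using Vnom_pos k\<phi>_pos
        by (intro divide_right_mono add_mono mult_left_mono order_refl) auto
    qed
    also have "\<dots> \<le> (2 * \<beta> * W + 2 * \<beta> * V + 2 * \<beta> * E + 2 * \<beta> * Y) / 2"
      unfolding mult.assoc[symmetric]
      using nonneg uw(1) uv(1) Vnom_pos k\<phi>_pos \<Lambda>(1) mult_pos_pos[OF Vnom_pos uv(1)]
        mult_pos_pos[OF k\<phi>_pos \<Lambda>(1)]
      by (intro divide_right_mono add_mono mult_right_mono mult_le_cancel_right1[THEN iffD2])
        (auto simp: \<beta>_def distrib_left intro: add_nonneg_nonneg)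
    finally show "energy w v e y \<le> \<beta> * (sqsum w v y + (\<Sum>i<n. (e i)\<^sup>2))"
      by (simp add: sqsum_def W_def V_def E_def Y_def algebra_simps)
    assume y: "(\<Sum>i<n. y i) = 0"
    have "\<alpha> * (W + V + Y + E) = (2 * \<alpha> * W + 2 * \<alpha> * V + 2 * \<alpha> * E + 2 * \<alpha> * Y) / 2"
      by (simp add: algebra_simps)
    also have "\<dots> \<le> (lw * W + Vnom * lv * V + 1 * E + k\<phi> / K * Y) / 2"
      using nonneg by (intro divide_right_mono add_mono mult_right_mono) (auto simp: \<alpha>_def)
    also have "\<dots> \<le> energy w v e y"
    proof -
      have "lw * W \<le> (\<Sum>i<n. u i * m i * (w i)\<^sup>2)"
        unfolding W_def sum_distrib_left using lw by (intro sum_mono mult_right_mono) auto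
      moreover have "Vnom * lv * V \<le> Vnom * (\<Sum>i<n. C i * (v i)\<^sup>2)"
        unfolding V_def sum_distrib_left using lv Vnom_pos
        by (intro sum_mono) (auto simp: mult.assoc intro!: mult_left_mono mult_right_mono)
      moreover have "k\<phi> / K * Y \<le> k\<phi> * dirichlet n a y y"
        using K k\<phi>_pos y by (simp add: Y_def field_simps)
      ultimately show ?thesis
        unfolding energy_def E_def by (intro divide_right_mono add_mono) simp_all
    qed
    finally show "\<alpha> * (sqsum w v y + (\<Sum>i<n. (e i)\<^sup>2)) \<le> energy w v e y"
      by (simp add: sqsum_def W_def V_def E_def Y_def add_ac)
  qed
qed

text \<open>Ensures that a small multiple of \<open>cross\<close> does not spoil the two-sided
  bounds on the energy.\<close>

lemma abs_cross_le:
  obtains c where "c > 0" "\<And>w v e y. \<bar>cross w e\<bar> \<le> c * (sqsum w v y + (\<Sum>i<n. (e i)\<^sup>2))"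
proof -
  obtain c where c: "c > 0" "\<And>i. i \<in> {..<n} \<Longrightarrow> u i * m i \<le> c"
    using finite_pos_upper_bound[of "{..<n}" "\<lambda>i. u i * m i"] by auto
  show thesis
  proof (rule that[OF c(1)])
    fix w v e y :: "nat \<Rightarrow> real"
    have "\<bar>cross w e\<bar> \<le> (\<Sum>i<n. \<bar>u i * m i * w i * e i\<bar>)"
      unfolding cross_def by (rule sum_abs)
    also have "\<dots> \<le> (\<Sum>i<n. c * ((w i)\<^sup>2 + (e i)\<^sup>2))"
    proof (rule sum_mono)
      fix i assume i: "i \<in> {..<n}"
      have "2 * \<bar>w i * e i\<bar> \<le> (w i)\<^sup>2 + (e i)\<^sup>2"
        using sum_squares_ge_zero[of "\<bar>w i\<bar> - \<bar>e i\<bar>" 0]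
        by (simp add: abs_mult power2_eq_square algebra_simps)
      then have "\<bar>w i * e i\<bar> \<le> (w i)\<^sup>2 + (e i)\<^sup>2"
        using abs_ge_zero[of "w i * e i"] by linarith
      then have "u i * m i * \<bar>w i * e i\<bar> \<le> c * ((w i)\<^sup>2 + (e i)\<^sup>2)"
        using c i by (intro mult_mono) auto
      then show "\<bar>u i * m i * w i * e i\<bar> \<le> c * ((w i)\<^sup>2 + (e i)\<^sup>2)"
        using u_pos[of i] m_pos[of i] i by (simp add: abs_mult mult.assoc)
    qed
    also have "\<dots> = c * ((\<Sum>i<n. (w i)\<^sup>2) + (\<Sum>i<n. (e i)\<^sup>2))"
      by (simp add: sum.distrib sum_distrib_left distrib_left)
    also have "\<dots> \<le> c * (sqsum w v y + (\<Sum>i<n. (e i)\<^sup>2))"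
      using c(1) by (intro mult_left_mono) (auto simp: sqsum_def intro!: add_nonneg_nonneg sum_nonneg)
    finally show "\<bar>cross w e\<bar> \<le> c * (sqsum w v y + (\<Sum>i<n. (e i)\<^sup>2))" .
  qed
qed

definition lyap where
  "lyap \<epsilon> w v e y = energy w v e y + \<epsilon> * cross w e"

text \<open>The cross term supplies the missing decay in \<open>e\<close>; what it costs in
  \<open>sqsum\<close> is absorbed by half of the coercive dissipation.\<close>

lemma strict_lyapunov_function:
  obtains \<alpha> \<beta> c \<epsilon> where "\<alpha> > 0" "\<beta> > 0" "c > 0"
    "\<And>w v e y. (\<Sum>i<n. y i) = 0 \<Longrightarrow> \<alpha> * (sqsum w v y + (\<Sum>i<n. (e i)\<^sup>2)) \<le> lyap \<epsilon> w v e y"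
    "\<And>w v e y. lyap \<epsilon> w v e y \<le> \<beta> * (sqsum w v y + (\<Sum>i<n. (e i)\<^sup>2))"
    "\<And>w v e y. (\<Sum>i<n. y i) = 0 \<Longrightarrow> - dissipation w v e y + \<epsilon> * cross_derivative w v e y
        \<le> - c * (sqsum w v y + (\<Sum>i<n. (e i)\<^sup>2))"
proof -
  obtain c0 where c0: "c0 > 0"
      "\<And>w v e y. (\<Sum>i<n. y i) = 0 \<Longrightarrow> c0 * sqsum w v y \<le> dissipation w v e y"
    using dissipation_coercive by blast
  obtain \<kappa> c1 where c1: "\<kappa> > 0" "c1 > 0"
      "\<And>w v e y. cross_derivative w v e y \<le> - \<kappa> * (\<Sum>i<n. (e i)\<^sup>2) + c1 * sqsum w v y"
    using cross_derivative_le by blast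
  obtain \<alpha> \<beta> where ab: "\<alpha> > 0" "\<beta> > 0"
      "\<And>w v e y. (\<Sum>i<n. y i) = 0 \<Longrightarrow> \<alpha> * (sqsum w v y + (\<Sum>i<n. (e i)\<^sup>2)) \<le> energy w v e y"
      "\<And>w v e y. energy w v e y \<le> \<beta> * (sqsum w v y + (\<Sum>i<n. (e i)\<^sup>2))"
    using energy_bounds by blast
  obtain d where d: "d > 0" "\<And>w v e y. \<bar>cross w e\<bar> \<le> d * (sqsum w v y + (\<Sum>i<n. (e i)\<^sup>2))"
    using abs_cross_le by blast
  \<comment> \<open>The first bound keeps half of the dissipation, the second half of the lower
    energy bound.\<close>
  define \<epsilon> where "\<epsilon> = min (c0 / (2 * c1)) (\<alpha> / (2 * d))"
  have \<epsilon>: "\<epsilon> > 0" "\<epsilon> * c1 \<le> c0 / 2" "\<epsilon> * d \<le> \<alpha> / 2"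
  proof -
    show "\<epsilon> > 0" using c0 c1 ab d by (simp add: \<epsilon>_def)
    have "\<epsilon> * c1 \<le> c0 / (2 * c1) * c1" "\<epsilon> * d \<le> \<alpha> / (2 * d) * d"
      unfolding \<epsilon>_def using c1(2) d(1) by (auto simp del: times_divide_eq_left intro!: mult_right_mono)
    then show "\<epsilon> * c1 \<le> c0 / 2" "\<epsilon> * d \<le> \<alpha> / 2" using c1 d by auto
  qed
  show thesis
  proof (rule that[of "\<alpha> / 2" "\<beta> + \<alpha> / 2" "min (c0 / 2) (\<epsilon> * \<kappa>)" \<epsilon>])
    show "\<alpha> / 2 > 0" "\<beta> + \<alpha> / 2 > 0" "min (c0 / 2) (\<epsilon> * \<kappa>) > 0"
      using ab c0 c1 \<epsilon> by auto
    fix w v e y :: "nat \<Rightarrow> real"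
    define N where "N = sqsum w v y + (\<Sum>i<n. (e i)\<^sup>2)"
    have nonneg: "sqsum w v y \<ge> 0" "(\<Sum>i<n. (e i)\<^sup>2) \<ge> 0"
      by (auto simp: sqsum_def intro!: add_nonneg_nonneg sum_nonneg)
    have "\<bar>\<epsilon> * cross w e\<bar> \<le> \<epsilon> * (d * N)"
      using d(2)[of w e v y] \<epsilon>(1) by (simp add: abs_mult N_def)
    also have "\<dots> \<le> \<alpha> / 2 * N"
      unfolding mult.assoc[symmetric] using \<epsilon>(3) nonneg by (intro mult_right_mono) (auto simp: N_def)
    finally have x: "\<bar>\<epsilon> * cross w e\<bar> \<le> \<alpha> / 2 * N" .
    show "lyap \<epsilon> w v e y \<le> (\<beta> + \<alpha> / 2) * (sqsum w v y + (\<Sum>i<n. (e i)\<^sup>2))"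
      using ab(4)[of w v e y] x unfolding lyap_def N_def[symmetric] by (simp add: distrib_right abs_le_iff)
    assume y: "(\<Sum>i<n. y i) = 0"
    show "\<alpha> / 2 * (sqsum w v y + (\<Sum>i<n. (e i)\<^sup>2)) \<le> lyap \<epsilon> w v e y"
      using ab(3)[OF y, of w v e] x unfolding lyap_def N_def[symmetric] by (simp add: abs_le_iff)
    have "\<epsilon> * cross_derivative w v e y \<le> \<epsilon> * (- \<kappa> * (\<Sum>i<n. (e i)\<^sup>2) + c1 * sqsum w v y)"
      using c1(3) \<epsilon>(1) by (intro mult_left_mono) auto
    also have "\<dots> = - (\<epsilon> * \<kappa>) * (\<Sum>i<n. (e i)\<^sup>2) + \<epsilon> * c1 * sqsum w v y"
      by (simp add: algebra_simps)
    also have "\<dots> \<le> - (\<epsilon> * \<kappa>) * (\<Sum>i<n. (e i)\<^sup>2) + c0 / 2 * sqsum w v y"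
      using \<epsilon>(2) nonneg by (intro add_mono mult_right_mono) auto
    finally have "- dissipation w v e y + \<epsilon> * cross_derivative w v e y
        \<le> - (c0 / 2) * sqsum w v y - (\<epsilon> * \<kappa>) * (\<Sum>i<n. (e i)\<^sup>2)"
      using c0(2)[OF y, of w v e] by simp
    moreover have "min (c0 / 2) (\<epsilon> * \<kappa>) * sqsum w v y \<le> c0 / 2 * sqsum w v y"
      "min (c0 / 2) (\<epsilon> * \<kappa>) * (\<Sum>i<n. (e i)\<^sup>2) \<le> \<epsilon> * \<kappa> * (\<Sum>i<n. (e i)\<^sup>2)"
      by (rule mult_right_mono, simp, rule nonneg)+
    ultimately show "- dissipation w v e y + \<epsilon> * cross_derivative w v e y
        \<le> - min (c0 / 2) (\<epsilon> * \<kappa>) * (sqsum w v y + (\<Sum>i<n. (e i)\<^sup>2))"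
      by (simp add: distrib_left)
  qed
qed

text \<open>The chain rule combined with \<open>energy_derivative\<close>. Derivatives are taken
  within a set because solutions have only a one-sided derivative at time 0.\<close>

lemma lyap_has_derivative:
  assumes "\<And>i. i < n \<Longrightarrow> ((\<lambda>t. w t i) has_real_derivative rhs\<omega> (w t) (v t) (e t) (y t) i) (at t within T)"
    and "\<And>i. i < n \<Longrightarrow> ((\<lambda>t. v t i) has_real_derivative rhsV (w t) (v t) (y t) i) (at t within T)"
    and "\<And>i. i < n \<Longrightarrow> ((\<lambda>t. e t i) has_real_derivative rhs\<eta> (w t) (e t) i) (at t within T)"
    and "\<And>i. i < n \<Longrightarrow> ((\<lambda>t. y t i) has_real_derivative rhs\<phi> (w t) (y t) i) (at t within T)"
  shows "((\<lambda>t. lyap \<epsilon> (w t) (v t) (e t) (y t)) has_real_derivative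
      - dissipation (w t) (v t) (e t) (y t) + \<epsilon> * cross_derivative (w t) (v t) (e t) (y t)) (at t within T)"
proof -
  have sq: "((\<lambda>t. (\<Sum>i<n. r i * (f t i)\<^sup>2)) has_real_derivative (\<Sum>i<n. 2 * (r i * f t i * g i))) (at t within T)"
    if "\<And>i. i < n \<Longrightarrow> ((\<lambda>t. f t i) has_real_derivative g i) (at t within T)"
    for f :: "real \<Rightarrow> nat \<Rightarrow> real" and g r
    using that by (intro DERIV_sum) (auto intro!: derivative_eq_intros)
  have dir: "((\<lambda>t. dirichlet n a (y t) (y t)) has_real_derivative
      (\<Sum>i<n. \<Sum>j<n. 2 * (a i j * (y t i - y t j) * (rhs\<phi> (w t) (y t) i - rhs\<phi> (w t) (y t) j))) / 2) (at t within T)"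
    unfolding dirichlet_def
    by (intro DERIV_cdivide DERIV_sum) (auto intro!: derivative_eq_intros assms(4) simp: algebra_simps)
  have cr: "((\<lambda>t. cross (w t) (e t)) has_real_derivative cross_derivative (w t) (v t) (e t) (y t)) (at t within T)"
    unfolding cross_def cross_derivative_def
    by (intro DERIV_sum) (auto intro!: derivative_eq_intros assms(1,3) simp: algebra_simps)
  have "((\<lambda>t. lyap \<epsilon> (w t) (v t) (e t) (y t)) has_real_derivative
     ((\<Sum>i<n. 2 * (u i * m i * w t i * rhs\<omega> (w t) (v t) (e t) (y t) i))
      + Vnom * (\<Sum>i<n. 2 * (C i * v t i * rhsV (w t) (v t) (y t) i))
      + (\<Sum>i<n. 2 * (1 * e t i * rhs\<eta> (w t) (e t) i))
      + k\<phi> * ((\<Sum>i<n. \<Sum>j<n. 2 * (a i j * (y t i - y t j) * (rhs\<phi> (w t) (y t) i - rhs\<phi> (w t) (y t) j))) / 2)) / 2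
      + \<epsilon> * cross_derivative (w t) (v t) (e t) (y t)) (at t within T)"
    using sq[of e _ "\<lambda>_. 1", OF assms(3)] unfolding lyap_def energy_def mult_1
    by (intro DERIV_add DERIV_cdivide DERIV_cmult sq dir cr assms) auto
  also have "((\<Sum>i<n. 2 * (u i * m i * w t i * rhs\<omega> (w t) (v t) (e t) (y t) i))
      + Vnom * (\<Sum>i<n. 2 * (C i * v t i * rhsV (w t) (v t) (y t) i))
      + (\<Sum>i<n. 2 * (1 * e t i * rhs\<eta> (w t) (e t) i))
      + k\<phi> * ((\<Sum>i<n. \<Sum>j<n. 2 * (a i j * (y t i - y t j) * (rhs\<phi> (w t) (y t) i - rhs\<phi> (w t) (y t) j))) / 2)) / 2
      = - dissipation (w t) (v t) (e t) (y t)"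
    unfolding energy_derivative[symmetric] dirichlet_def sum_distrib_left[symmetric]
    by (simp add: add_divide_distrib)
  finally show ?thesis .
qed

end

section \<open>Lyapunov's direct method for linear systems\<close>

lemma eucl_norm_squared: "(eucl_norm v)\<^sup>2 = v \<bullet> v"
  unfolding eucl_norm_def by (simp add: scalar_prod_def sum_nonneg)

text \<open>The bounds give \<open>D v \<le> - (c / \<beta>) * F v\<close>, so \<open>F\<close>
  times the integrating factor \<open>exp (\<rho> * t)\<close> is nonincreasing along solutions.
  Comparing \<open>F\<close> with the squared norm yields exponential decay, hence both halves of
  the definition.\<close>

lemma lyapunov_globally_asymptotically_stable:
  fixes A :: "real mat" and F D :: "real vec \<Rightarrow> real"
  assumes A: "A \<in> carrier_mat k k"
    and pos: "\<alpha> > 0" "\<beta> > 0" "c > 0"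
    and lower: "\<And>v. v \<in> carrier_vec k \<Longrightarrow> \<alpha> * (v \<bullet> v) \<le> F v"
    and upper: "\<And>v. v \<in> carrier_vec k \<Longrightarrow> F v \<le> \<beta> * (v \<bullet> v)"
    and decrease: "\<And>v. v \<in> carrier_vec k \<Longrightarrow> D v \<le> - c * (v \<bullet> v)"
    and deriv: "\<And>x t. linear_system_solution A x \<Longrightarrow> t \<ge> 0 \<Longrightarrow>
      ((\<lambda>s. F (x s)) has_real_derivative D (x t)) (at t within {0..})"
  shows "globally_asymptotically_stable A"
proof -
  define \<rho> where "\<rho> = c / \<beta>"
  have \<rho>: "\<rho> > 0"
    using pos by (simp add: \<rho>_def)
  have decay: "(eucl_norm (x t))\<^sup>2 \<le> \<beta> / \<alpha> * (eucl_norm (x 0))\<^sup>2 * exp (- \<rho> * t)"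
    if x: "linear_system_solution A x" and t: "t \<ge> 0" for x t
  proof -
    have x_carrier: "x s \<in> carrier_vec k" if "s \<ge> 0" for s
      using x A that by (auto simp: linear_system_solution_def)
    define g where "g s = exp (\<rho> * s) * F (x s)" for s
    have g: "(g has_real_derivative exp (\<rho> * s) * (\<rho> * F (x s) + D (x s))) (at s within {0..})"
      if "s \<ge> 0" for s
      unfolding g_def
      by (rule derivative_eq_intros deriv[OF x that] refl | simp add: algebra_simps)+
    have "g t \<le> g 0"
    proof (rule DERIV_nonpos_imp_decreasing_open[OF t])
      show "continuous_on {0..t} g"
        by (rule continuous_on_subset[of "{0..}"])
          (auto simp: continuous_on_eq_continuous_within intro!: DERIV_continuous[OF g])
    next
      fix s assume s: "0 < s" "s < t"
      have "D (x s) \<le> - c * (x s \<bullet> x s)"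
        using decrease x_carrier s by simp
      moreover have "\<rho> * F (x s) \<le> \<rho> * (\<beta> * (x s \<bullet> x s))"
        using upper x_carrier s \<rho> by (intro mult_left_mono) auto
      moreover have "\<rho> * \<beta> = c"
        using pos by (simp add: \<rho>_def)
      ultimately have "\<rho> * F (x s) + D (x s) \<le> 0"
        by (simp add: mult.assoc[symmetric])
      moreover have "(g has_real_derivative exp (\<rho> * s) * (\<rho> * F (x s) + D (x s))) (at s)"
      proof -
        \<comment> \<open>At an interior time the one-sided derivative is a full derivative, by
          restriction to an open half-line.\<close>
        have "(g has_real_derivative exp (\<rho> * s) * (\<rho> * F (x s) + D (x s))) (at s within {0<..})"
          by (rule has_field_derivative_subset[OF g]) (use s in auto)
        then show ?thesis
          using s at_within_open[of s "{0<..}"] by simp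
      qed
      ultimately show "\<exists>y. (g has_real_derivative y) (at s) \<and> y \<le> 0"
        by (intro exI[of _ "exp (\<rho> * s) * (\<rho> * F (x s) + D (x s))"])
          (simp add: mult_nonneg_nonpos)
    qed
    then have "F (x t) \<le> F (x 0) * exp (- \<rho> * t)"
      by (simp add: g_def exp_minus field_simps)
    also have "\<dots> \<le> \<beta> * (x 0 \<bullet> x 0) * exp (- \<rho> * t)"
      using upper[OF x_carrier] by (intro mult_right_mono) auto
    finally have "\<alpha> * (x t \<bullet> x t) \<le> \<beta> * (x 0 \<bullet> x 0) * exp (- \<rho> * t)"
      using lower[OF x_carrier[OF t]] by simp
    then show ?thesis
      using pos by (simp add: eucl_norm_squared field_simps)
  qed
  have norm_nonneg: "eucl_norm v \<ge> 0" for v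
    unfolding eucl_norm_def by (simp add: scalar_prod_def sum_nonneg)
  have "\<exists>\<delta>>0. \<forall>x. linear_system_solution A x \<and> eucl_norm (x 0) < \<delta> \<longrightarrow> (\<forall>t\<ge>0. eucl_norm (x t) < \<epsilon>)"
    if \<epsilon>: "\<epsilon> > 0" for \<epsilon>
  proof (intro exI conjI allI impI; (elim conjE)?)
    \<comment> \<open>This radius makes \<open>\<beta> / \<alpha>\<close> times its square equal to
      the square of \<epsilon>.\<close>
    show "\<epsilon> * sqrt (\<alpha> / \<beta>) > 0" using \<epsilon> pos by simp
    fix x :: "real \<Rightarrow> real vec" and t :: real
    assume x: "linear_system_solution A x" "eucl_norm (x 0) < \<epsilon> * sqrt (\<alpha> / \<beta>)" and t: "t \<ge> 0"
    have "(eucl_norm (x t))\<^sup>2 \<le> \<beta> / \<alpha> * (eucl_norm (x 0))\<^sup>2 * exp (- \<rho> * t)"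
      by (rule decay[OF x(1) t])
    also have "\<dots> \<le> \<beta> / \<alpha> * (eucl_norm (x 0))\<^sup>2 * 1"
      using pos \<rho> t by (intro mult_left_mono) auto
    also have "\<dots> < \<beta> / \<alpha> * (\<epsilon> * sqrt (\<alpha> / \<beta>))\<^sup>2 * 1"
      using pos x(2) norm_nonneg by (intro mult_strict_right_mono mult_strict_left_mono power_strict_mono) auto
    also have "\<dots> = \<epsilon>\<^sup>2"
      using pos by (simp add: power_mult_distrib)
    finally show "eucl_norm (x t) < \<epsilon>"
      using \<epsilon> by (simp add: power_less_imp_less_base)
  qed
  moreover have "((\<lambda>t. eucl_norm (x t)) \<longlongrightarrow> 0) at_top" if x: "linear_system_solution A x" for x
  proof -
    have "filterlim (\<lambda>t. - \<rho> * t) at_bot at_top"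
      using \<rho> by (intro filterlim_tendsto_neg_mult_at_bot[OF tendsto_const] filterlim_ident) auto
    then have "((\<lambda>t. exp (- \<rho> * t)) \<longlongrightarrow> 0) at_top"
      by (rule filterlim_compose[OF exp_at_bot])
    then have lim: "((\<lambda>t. \<beta> / \<alpha> * (eucl_norm (x 0))\<^sup>2 * exp (- \<rho> * t)) \<longlongrightarrow> 0) at_top"
      by (rule tendsto_mult_right_zero)
    have "((\<lambda>t. (eucl_norm (x t))\<^sup>2) \<longlongrightarrow> 0) at_top"
      using decay[OF x] by (intro tendsto_sandwich[OF _ _ tendsto_const lim])
        (auto intro!: eventually_at_top_linorderI[of 0])
    then have "((\<lambda>t. sqrt ((eucl_norm (x t))\<^sup>2)) \<longlongrightarrow> sqrt 0) at_top"
      by (rule tendsto_real_sqrt)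
    then show ?thesis
      by (simp add: norm_nonneg)
  qed
  ultimately show ?thesis
    using A unfolding globally_asymptotically_stable_def by auto
qed

section \<open>The closed-loop system\<close>

text \<open>Passes from matrix entries to differences: the diagonal degree multiplies
  \<open>x $ i\<close>, and the other entries subtract the neighbours.\<close>

lemma weighted_laplacian_mult_vec:
  assumes "pair_graph G" "x \<in> carrier_vec n" "i < n"
  shows "(weighted_laplacian n G w *\<^sub>v x) $ i =
    laplacian n (\<lambda>i j. if (i, j) \<in> parcs G then w i j else 0) (\<lambda>j. x $ j) i"
proof -
  interpret pair_graph G by fact
  define a where "a i j = (if (i, j) \<in> parcs G then w i j else 0)" for i j
  \<comment> \<open>Without loops the off-diagonal expression \<open>- a i j * x $ j\<close>
    vanishes at \<open>j = i\<close> and may be included there.\<close>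
  have loop: "a i i = 0" using pair_no_loops[of "(i, i)"] by (auto simp: a_def)
  have deg: "(\<Sum>k \<in> {k \<in> {0..<n}. (i, k) \<in> parcs G}. w i k) = (\<Sum>k<n. a i k)"
    unfolding a_def atLeast0LessThan by (rule sum.inter_filter) simp
  have "(weighted_laplacian n G w *\<^sub>v x) $ i =
      (\<Sum>j<n. (if i = j then (\<Sum>k<n. a i k) else - a i j) * x $ j)"
    using assms(2,3) unfolding weighted_laplacian_def deg[symmetric]
    by (auto simp: scalar_prod_def atLeast0LessThan a_def intro!: sum.cong)
  also have "\<dots> = (\<Sum>j<n. (if i = j then (\<Sum>k<n. a i k) * x $ i else 0) - a i j * x $ j)"
    using loop by (intro sum.cong) auto
  also have "\<dots> = (\<Sum>j<n. a i j) * x $ i - (\<Sum>j<n. a i j * x $ j)"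
    using assms(3) by (simp add: sum_subtractf)
  also have "\<dots> = laplacian n a (\<lambda>j. x $ j) i"
    by (simp add: laplacian_def sum_distrib_right sum_subtractf right_diff_distrib)
  finally show ?thesis unfolding a_def .
qed

text \<open>The columns of the augmented matrix are orthonormal, and so are its rows. Comparison
  with the constant first column gives the zero sums; removing that column from the row products
  subtracts \<open>1 / n\<close>.\<close>

lemma orthogonal_ones_augmented:
  assumes "n \<ge> 1" and S: "S \<in> carrier_mat n (n - 1)" and orth: "is_orthogonal (ones_augmented n S)"
  shows sum_column: "\<And>k. k < n - 1 \<Longrightarrow> (\<Sum>i<n. S $$ (i, k)) = 0"
    and sum_column_mult: "\<And>k l. k < n - 1 \<Longrightarrow> l < n - 1 \<Longrightarrow>
      (\<Sum>i<n. S $$ (i, k) * S $$ (i, l)) = (if k = l then 1 else 0)"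
    and sum_row_mult: "\<And>i j. i < n \<Longrightarrow> j < n \<Longrightarrow>
      (\<Sum>k<n - 1. S $$ (i, k) * S $$ (j, k)) = (if i = j then 1 else 0) - 1 / n"
proof -
  define Q where "Q = ones_augmented n S"
  have dim: "Q \<in> carrier_mat n n"
    using S assms(1) by (auto simp: Q_def ones_augmented_def)
  have Q0: "Q $$ (i, 0) = 1 / sqrt n" if "i < n" for i
    using that S assms(1) by (simp add: Q_def ones_augmented_def mat_of_cols_def)
  have QSuc: "Q $$ (i, Suc k) = S $$ (i, k)" if "i < n" "k < n - 1" for i k
    using that S assms(1) by (simp add: Q_def ones_augmented_def mat_of_cols_def cols_def)
  have col: "(\<Sum>i<n. Q $$ (i, k) * Q $$ (i, l)) = (if k = l then 1 else 0)" if "k < n" "l < n" for k l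
  proof -
    have "transpose_mat Q * Q = 1\<^sub>m n"
      using orth dim unfolding is_orthogonal_def Q_def[symmetric] inverts_mat_def by auto
    then have "(transpose_mat Q * Q) $$ (k, l) = 1\<^sub>m n $$ (k, l)" by simp
    then show ?thesis
      using that dim by (simp add: scalar_prod_def atLeast0LessThan)
  qed
  have row: "(\<Sum>k<n. Q $$ (i, k) * Q $$ (j, k)) = (if i = j then 1 else 0)" if "i < n" "j < n" for i j
  proof -
    have "Q * transpose_mat Q = 1\<^sub>m n"
      using orth dim unfolding is_orthogonal_def Q_def[symmetric] inverts_mat_def by auto
    then have "(Q * transpose_mat Q) $$ (i, j) = 1\<^sub>m n $$ (i, j)" by simp
    then show ?thesis
      using that dim by (simp add: scalar_prod_def atLeast0LessThan)
  qed
  show "(\<Sum>i<n. S $$ (i, k)) = 0" if "k < n - 1" for k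
  proof -
    have "0 = (\<Sum>i<n. Q $$ (i, 0) * Q $$ (i, Suc k))"
      using col[of 0 "Suc k"] that by simp
    also have "\<dots> = 1 / sqrt n * (\<Sum>i<n. S $$ (i, k))"
      using that by (simp add: Q0 QSuc sum_distrib_left)
    finally show ?thesis using assms(1) by simp
  qed
  show "(\<Sum>i<n. S $$ (i, k) * S $$ (i, l)) = (if k = l then 1 else 0)" if "k < n - 1" "l < n - 1" for k l
    using col[of "Suc k" "Suc l"] that by (simp add: QSuc)
  show "(\<Sum>k<n - 1. S $$ (i, k) * S $$ (j, k)) = (if i = j then 1 else 0) - 1 / n"
    if "i < n" "j < n" for i j
  proof -
    \<comment> \<open>Writing \<open>n\<close> as \<open>Suc (n - 1)\<close> splits off column 0,
      the constant one.\<close>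
    have "(\<Sum>k<Suc (n - 1). Q $$ (i, k) * Q $$ (j, k)) = (if i = j then 1 else 0)"
      using row[OF that] assms(1) by simp
    then show ?thesis
      unfolding sum.lessThan_Suc_shift using that by (simp add: Q0 QSuc)
  qed
qed

lemma mat_diag_mult_vec:
  fixes x :: "real vec"
  assumes "dim_vec x = n" "i < n"
  shows "(mat_diag n f *\<^sub>v x) $ i = f i * x $ i"
proof -
  have "(mat_diag n f *\<^sub>v x) $ i = (\<Sum>j<n. (if i = j then f j else 0) * x $ j)"
    using assms by (simp add: mat_diag_def scalar_prod_def atLeast0LessThan)
  also have "\<dots> = (\<Sum>j<n. if i = j then f i * x $ i else 0)"
    by (intro sum.cong) auto
  finally show ?thesis using assms by simp
qed

text \<open>The Laplacian matrices enter through their action on vectors, which separates the matrix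
  computation from the graph.\<close>

locale hvdc_matrices = hvdc +
  fixes L\<^sub>R L\<^sub>\<eta> L\<^sub>\<phi> S :: "real mat"
  assumes L\<^sub>R: "L\<^sub>R \<in> carrier_mat n n"
      "\<And>x i. x \<in> carrier_vec n \<Longrightarrow> i < n \<Longrightarrow> (L\<^sub>R *\<^sub>v x) $ i = laplacian n a (\<lambda>j. x $ j) i"
    and L\<^sub>\<eta>: "L\<^sub>\<eta> \<in> carrier_mat n n"
      "\<And>x i. x \<in> carrier_vec n \<Longrightarrow> i < n \<Longrightarrow> (L\<^sub>\<eta> *\<^sub>v x) $ i = laplacian n b (\<lambda>j. x $ j) i"
    and L\<^sub>\<phi>: "L\<^sub>\<phi> = k\<phi> \<cdot>\<^sub>m L\<^sub>R"
    and n_pos: "n \<ge> 1"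
    and S: "S \<in> carrier_mat n (n - 1)" "is_orthogonal (ones_augmented n S)"
begin

abbreviation A :: "real mat" where
  "A \<equiv> closed_loop_matrix n Vnom \<gamma> m C k\<omega> kV kD kI L\<^sub>R L\<^sub>\<eta> L\<^sub>\<phi> S"

abbreviation N :: nat where
  "N \<equiv> n + (n + (n + (n - 1)))"

definition \<omega>_of :: "real vec \<Rightarrow> nat \<Rightarrow> real" where "\<omega>_of x i = x $ i"
definition V_of :: "real vec \<Rightarrow> nat \<Rightarrow> real" where "V_of x i = x $ (n + i)"
definition \<eta>_of :: "real vec \<Rightarrow> nat \<Rightarrow> real" where "\<eta>_of x i = x $ (n + (n + i))"
definition \<phi>_of :: "real vec \<Rightarrow> nat \<Rightarrow> real" where "\<phi>_of x k = x $ (n + (n + (n + k)))"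
definition y_of :: "real vec \<Rightarrow> nat \<Rightarrow> real" where "y_of x i = (\<Sum>k<n - 1. S $$ (i, k) * \<phi>_of x k)"

lemmas column_sums = sum_column[OF n_pos S] sum_column_mult[OF n_pos S]
  and row_sums = sum_row_mult[OF n_pos S]

lemma A_carrier: "A \<in> carrier_mat N N"
  unfolding closed_loop_matrix_def Let_def carrier_mat_def using S(1) L\<^sub>\<eta>(1)
  by (simp add: mat_diag_def add_ac)

lemma split_state:
  assumes "x \<in> carrier_vec N"
  shows "x = vec n (\<omega>_of x) @\<^sub>v vec n (V_of x) @\<^sub>v vec n (\<eta>_of x) @\<^sub>v vec (n - 1) (\<phi>_of x)"
  using assms by (intro eq_vecI) (auto simp: \<omega>_of_def V_of_def \<eta>_of_def \<phi>_of_def)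

text \<open>Links the block matrix to the scalar vector field. The last block stays in \<phi>; its
  image under \<open>S\<close> is treated in \<open>y_of_closed_loop\<close>.\<close>

lemma closed_loop_components:
  assumes x: "x \<in> carrier_vec N"
  shows "\<And>i. i < n \<Longrightarrow> \<omega>_of (A *\<^sub>v x) i = rhs\<omega> (\<omega>_of x) (V_of x) (\<eta>_of x) (y_of x) i"
    and "\<And>i. i < n \<Longrightarrow> V_of (A *\<^sub>v x) i = rhsV (\<omega>_of x) (V_of x) (y_of x) i"
    and "\<And>i. i < n \<Longrightarrow> \<eta>_of (A *\<^sub>v x) i = rhs\<eta> (\<omega>_of x) (\<eta>_of x) i"
    and "\<And>k. k < n - 1 \<Longrightarrow> \<phi>_of (A *\<^sub>v x) k = (\<Sum>i<n. S $$ (i, k) * (u i * \<omega>_of x i)) - \<gamma> * \<phi>_of x k"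
proof -
  define W where "W = vec n (\<omega>_of x)"
  define V where "V = vec n (V_of x)"
  define H where "H = vec n (\<eta>_of x)"
  define P where "P = vec (n - 1) (\<phi>_of x)"
  have car: "W \<in> carrier_vec n" "V \<in> carrier_vec n" "H \<in> carrier_vec n" "P \<in> carrier_vec (n - 1)"
    by (simp_all add: W_def V_def H_def P_def)
  have L\<^sub>\<phi>_carrier: "L\<^sub>\<phi> \<in> carrier_mat n n" using L\<^sub>R(1) by (simp add: L\<^sub>\<phi>)
  define M where "M = mat_diag n (\<lambda>i. inverse (m i))"
  define E where "E = mat_diag n (\<lambda>i. inverse (C i))"
  define K\<omega> where "K\<omega> = mat_diag n k\<omega>"
  define K\<omega>inv where "K\<omega>inv = mat_diag n (\<lambda>i. inverse (k\<omega> i))"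
  define KV where "KV = mat_diag n kV"
  define KVinv where "KVinv = mat_diag n (\<lambda>i. inverse (kV i))"
  define KD where "KD = mat_diag n kD"
  define KI where "KI = mat_diag n kI"
  have D: "M \<in> carrier_mat n n" "E \<in> carrier_mat n n" "K\<omega> \<in> carrier_mat n n"
    "K\<omega>inv \<in> carrier_mat n n" "KV \<in> carrier_mat n n" "KVinv \<in> carrier_mat n n"
    "KD \<in> carrier_mat n n" "KI \<in> carrier_mat n n"
    by (simp_all add: M_def E_def K\<omega>_def K\<omega>inv_def KV_def KVinv_def KD_def KI_def)
  note dims = D[THEN carrier_matD(1)]
  note comp = mat_diag_mult_vec[of _ n _ "\<lambda>i. inverse (m i)", folded M_def]
    mat_diag_mult_vec[of _ n _ "\<lambda>i. inverse (C i)", folded E_def]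
    mat_diag_mult_vec[of _ n _ k\<omega>, folded K\<omega>_def]
    mat_diag_mult_vec[of _ n _ "\<lambda>i. inverse (k\<omega> i)", folded K\<omega>inv_def]
    mat_diag_mult_vec[of _ n _ kV, folded KV_def]
    mat_diag_mult_vec[of _ n _ "\<lambda>i. inverse (kV i)", folded KVinv_def]
    mat_diag_mult_vec[of _ n _ kD, folded KD_def]
    mat_diag_mult_vec[of _ n _ kI, folded KI_def]
  have LS_carrier: "L\<^sub>\<phi> * S \<in> carrier_mat n (n - 1)"
    by (rule mult_carrier_mat[OF L\<^sub>\<phi>_carrier S(1)])
  have SP: "S *\<^sub>v P = vec n (y_of x)"
    using S(1) by (intro eq_vecI) (auto simp: P_def y_of_def scalar_prod_def atLeast0LessThan)
  have laplacian_vec: "laplacian n c (\<lambda>j. vec n f $ j) i = laplacian n c f i" if "i < n" for c f i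
    using that by (simp add: laplacian_def)
  have LS: "((L\<^sub>\<phi> * S) *\<^sub>v P) $ i = k\<phi> * laplacian n a (y_of x) i" if i: "i < n" for i
  proof -
    have "(L\<^sub>\<phi> * S) *\<^sub>v P = k\<phi> \<cdot>\<^sub>v (L\<^sub>R *\<^sub>v vec n (y_of x))"
      unfolding assoc_mult_mat_vec[OF L\<^sub>\<phi>_carrier S(1) car(4)] SP
      unfolding L\<^sub>\<phi> by (rule smult_mult_mat_vec_carrier[OF L\<^sub>R(1)]) simp
    then show ?thesis
      using i L\<^sub>R(1) by (simp del: index_mult_mat_vec add: L\<^sub>R(2) laplacian_vec)
  qed
  \<comment> \<open>Opaque names for the products, so that each can be evaluated factor by
    factor.\<close>
  define v1 where "v1 = (KD + K\<omega>) *\<^sub>v W"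
  define v2 where "v2 = KV *\<^sub>v V"
  define v3 where "v3 = (KV * K\<omega>inv * KI) *\<^sub>v H"
  define v4 where "v4 = (L\<^sub>\<phi> * S) *\<^sub>v P"
  define v5 where "v5 = (E * K\<omega>) *\<^sub>v W"
  define v6 where "v6 = (E * (L\<^sub>R + (1 / Vnom) \<cdot>\<^sub>m KV)) *\<^sub>v V"
  define v7 where "v7 = (E * (L\<^sub>\<phi> * S)) *\<^sub>v P"
  define v8 where "v8 = KI *\<^sub>v W"
  define v9 where "v9 = L\<^sub>\<eta> *\<^sub>v H"
  define v10 where "v10 = (transpose_mat S * KVinv * K\<omega>) *\<^sub>v W"
  have Ax: "A *\<^sub>v x = (M *\<^sub>v (- v1 + v2 - v3 - v4)) @\<^sub>v
      ((1 / Vnom) \<cdot>\<^sub>v v5 - v6 + (1 / Vnom) \<cdot>\<^sub>v v7) @\<^sub>v (v8 - v9) @\<^sub>v (v10 - \<gamma> \<cdot>\<^sub>v P)"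
    unfolding v1_def v2_def v3_def v4_def v5_def v6_def v7_def v8_def v9_def v10_def
    by (subst split_state[OF x], fold W_def V_def H_def P_def)
      (rule closed_loop_matrix_mult[OF L\<^sub>R(1) L\<^sub>\<eta>(1) L\<^sub>\<phi>_carrier S(1) car
          M_def E_def K\<omega>_def K\<omega>inv_def KV_def KVinv_def KD_def KI_def])
  have dim: "dim_vec v1 = n" "dim_vec v2 = n" "dim_vec v3 = n" "dim_vec v4 = n" "dim_vec v5 = n"
    "dim_vec v6 = n" "dim_vec v7 = n" "dim_vec v8 = n" "dim_vec v9 = n" "dim_vec v10 = n - 1"
    "dim_vec P = n - 1"
    using dims L\<^sub>\<phi>_carrier L\<^sub>\<eta>(1) S(1)
    by (simp_all add: v1_def v2_def v3_def v4_def v5_def v6_def v7_def v8_def v9_def v10_def P_def)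
  have c1: "v1 $ i = (kD i + k\<omega> i) * \<omega>_of x i" if "i < n" for i
    unfolding v1_def add_mult_distrib_mat_vec[OF D(7) D(3) car(1)]
    using that dims by (simp del: index_mult_mat_vec add: comp W_def distrib_right)
  have c2: "v2 $ i = kV i * V_of x i" if "i < n" for i
    unfolding v2_def using that by (simp del: index_mult_mat_vec add: comp V_def)
  have c3: "v3 $ i = kV i / k\<omega> i * kI i * \<eta>_of x i" if "i < n" for i
    unfolding v3_def assoc_mult_mat_vec[OF mult_carrier_mat[OF D(5) D(4)] D(8) car(3)]
      assoc_mult_mat_vec[OF D(5) D(4) mult_mat_vec_carrier[OF D(8) car(3)]]
    using that dims by (simp del: index_mult_mat_vec add: comp H_def divide_inverse)
  have c4: "v4 $ i = k\<phi> * laplacian n a (y_of x) i" if "i < n" for i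
    unfolding v4_def by (rule LS[OF that])
  have c5: "v5 $ i = inverse (C i) * (k\<omega> i * \<omega>_of x i)" if "i < n" for i
    unfolding v5_def assoc_mult_mat_vec[OF D(2) D(3) car(1)]
    using that dims by (simp del: index_mult_mat_vec add: comp W_def)
  have c6: "v6 $ i = inverse (C i) * (laplacian n a (V_of x) i + kV i * V_of x i / Vnom)" if "i < n" for i
  proof -
    have "L\<^sub>R + (1 / Vnom) \<cdot>\<^sub>m KV \<in> carrier_mat n n"
      using D(5) by simp
    then have "v6 = E *\<^sub>v (L\<^sub>R *\<^sub>v V + (1 / Vnom) \<cdot>\<^sub>v (KV *\<^sub>v V))"
      unfolding v6_def smult_mult_mat_vec_carrier[OF D(5) car(2), symmetric]
      by (subst assoc_mult_mat_vec[OF D(2) _ car(2)])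
        (simp_all add: add_mult_distrib_mat_vec[OF L\<^sub>R(1) smult_carrier_mat[OF D(5)] car(2)])
    then show ?thesis
      using that dims L\<^sub>R(1) L\<^sub>R(2)[OF car(2) that] by (simp del: index_mult_mat_vec add: comp V_def laplacian_vec)
  qed
  have c7: "v7 $ i = inverse (C i) * (k\<phi> * laplacian n a (y_of x) i)" if "i < n" for i
    unfolding v7_def assoc_mult_mat_vec[OF D(2) LS_carrier car(4)] v4_def[symmetric]
    using that by (simp del: index_mult_mat_vec add: dim comp c4)
  have c8: "v8 $ i = kI i * \<omega>_of x i" if "i < n" for i
    unfolding v8_def using that by (simp del: index_mult_mat_vec add: comp W_def)
  have c9: "v9 $ i = laplacian n b (\<eta>_of x) i" if "i < n" for i
    unfolding v9_def using that by (simp del: index_mult_mat_vec add: L\<^sub>\<eta>(2) H_def laplacian_vec)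
  have c10: "v10 $ k = (\<Sum>i<n. S $$ (i, k) * (u i * \<omega>_of x i))" if "k < n - 1" for k
  proof -
    have St: "transpose_mat S \<in> carrier_mat (n - 1) n" using S(1) by simp
    show ?thesis
      unfolding v10_def assoc_mult_mat_vec[OF mult_carrier_mat[OF St D(6)] D(3) car(1)]
        assoc_mult_mat_vec[OF St D(6) mult_mat_vec_carrier[OF D(3) car(1)]]
      using that S(1) dims
      by (subst index_mult_mat_vec)
        (auto simp del: index_mult_mat_vec simp: scalar_prod_def atLeast0LessThan comp
          W_def u_def divide_inverse intro!: sum.cong)
  qed
  show "\<omega>_of (A *\<^sub>v x) i = rhs\<omega> (\<omega>_of x) (V_of x) (\<eta>_of x) (y_of x) i" if i: "i < n" for i
  proof -
    have "\<omega>_of (A *\<^sub>v x) i = inverse (m i) * (- v1 $ i + v2 $ i - v3 $ i - v4 $ i)"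
      unfolding Ax \<omega>_of_def using i by (simp del: index_mult_mat_vec add: dim dims comp)
    then show ?thesis
      unfolding rhs\<omega>_def c1[OF i] c2[OF i] c3[OF i] c4[OF i] by (simp add: divide_inverse algebra_simps)
  qed
  show "V_of (A *\<^sub>v x) i = rhsV (\<omega>_of x) (V_of x) (y_of x) i" if i: "i < n" for i
  proof -
    have "V_of (A *\<^sub>v x) i = 1 / Vnom * v5 $ i - v6 $ i + 1 / Vnom * v7 $ i"
      unfolding Ax V_of_def using i by (simp add: dim dims)
    then show ?thesis
      unfolding rhsV_def c5[OF i] c6[OF i] c7[OF i] by (simp add: divide_inverse algebra_simps)
  qed
  show "\<eta>_of (A *\<^sub>v x) i = rhs\<eta> (\<omega>_of x) (\<eta>_of x) i" if "i < n" for i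
    unfolding Ax \<eta>_of_def[of "_ @\<^sub>v _"] using that by (simp add: dim dims c8 c9 rhs\<eta>_def)
  show "\<phi>_of (A *\<^sub>v x) k = (\<Sum>i<n. S $$ (i, k) * (u i * \<omega>_of x i)) - \<gamma> * \<phi>_of x k" if "k < n - 1" for k
    unfolding Ax \<phi>_of_def[of "_ @\<^sub>v _"]
    using that by (simp add: dim dims c10) (simp add: P_def)
qed

text \<open>The columns of \<open>S\<close> have sum zero; this is what makes the Poincare
  inequality applicable to \<open>y\<close>.\<close>

lemma sum_y_of: "(\<Sum>i<n. y_of x i) = 0"
proof -
  have "(\<Sum>i<n. y_of x i) = (\<Sum>k<n - 1. (\<Sum>i<n. S $$ (i, k)) * \<phi>_of x k)"
    unfolding y_of_def sum_distrib_right by (rule sum.swap)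
  then show ?thesis by (simp add: column_sums)
qed

text \<open>Orthonormal columns make \<open>S\<close> an isometry, so estimates in \<open>y\<close>
  are estimates in \<phi>.\<close>

lemma sum_y_of_squared: "(\<Sum>i<n. (y_of x i)\<^sup>2) = (\<Sum>k<n - 1. (\<phi>_of x k)\<^sup>2)"
proof -
  have "(\<Sum>i<n. (y_of x i)\<^sup>2) = (\<Sum>i<n. \<Sum>k<n - 1. \<Sum>l<n - 1. S $$ (i, k) * S $$ (i, l) * (\<phi>_of x k * \<phi>_of x l))"
    by (simp add: y_of_def power2_eq_square sum_product mult_ac)
  also have "\<dots> = (\<Sum>k<n - 1. \<Sum>i<n. \<Sum>l<n - 1. S $$ (i, k) * S $$ (i, l) * (\<phi>_of x k * \<phi>_of x l))"
    by (rule sum.swap)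
  also have "\<dots> = (\<Sum>k<n - 1. \<Sum>l<n - 1. \<Sum>i<n. S $$ (i, k) * S $$ (i, l) * (\<phi>_of x k * \<phi>_of x l))"
    by (intro sum.cong refl sum.swap)
  also have "\<dots> = (\<Sum>k<n - 1. \<Sum>l<n - 1. if k = l then (\<phi>_of x k)\<^sup>2 else 0)"
    by (intro sum.cong refl)
      (simp add: sum_distrib_right[symmetric] column_sums power2_eq_square)
  also have "\<dots> = (\<Sum>k<n - 1. (\<phi>_of x k)\<^sup>2)"
    by simp
  finally show ?thesis .
qed

lemma scalar_prod_self:
  assumes "x \<in> carrier_vec N"
  shows "x \<bullet> x = sqsum (\<omega>_of x) (V_of x) (y_of x) + (\<Sum>i<n. (\<eta>_of x i)\<^sup>2)"
proof -
  have split: "(\<Sum>i<p + q. f i) = (\<Sum>i<p. f i) + (\<Sum>i<q. f (p + i))" for p q and f :: "nat \<Rightarrow> real"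
    by (induction q) auto
  have "x \<bullet> x = (\<Sum>i<N. (x $ i)\<^sup>2)"
    using assms by (simp add: scalar_prod_def power2_eq_square atLeast0LessThan)
  also have "\<dots> = (\<Sum>i<n. (\<omega>_of x i)\<^sup>2) + ((\<Sum>i<n. (V_of x i)\<^sup>2) + ((\<Sum>i<n. (\<eta>_of x i)\<^sup>2) + (\<Sum>k<n - 1. (\<phi>_of x k)\<^sup>2)))"
    unfolding split \<omega>_of_def V_of_def \<eta>_of_def \<phi>_of_def ..
  finally show ?thesis
    by (simp add: sqsum_def sum_y_of_squared)
qed

text \<open>Applying \<open>S\<close> to the last equation produces
  \<open>S * transpose_mat S\<close>, whose entries \<open>row_sums\<close> gives: the identity
  minus averaging.\<close>

lemma y_of_closed_loop:
  assumes "x \<in> carrier_vec N" "i < n"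
  shows "y_of (A *\<^sub>v x) i = rhs\<phi> (\<omega>_of x) (y_of x) i"
proof -
  have "y_of (A *\<^sub>v x) i = (\<Sum>k<n - 1. \<Sum>j<n. S $$ (i, k) * S $$ (j, k) * (u j * \<omega>_of x j)) - \<gamma> * y_of x i"
    unfolding y_of_def
    by (simp add: closed_loop_components(4)[OF assms(1)] right_diff_distrib sum_subtractf sum_distrib_left mult_ac)
  also have "(\<Sum>k<n - 1. \<Sum>j<n. S $$ (i, k) * S $$ (j, k) * (u j * \<omega>_of x j))
      = (\<Sum>j<n. (\<Sum>k<n - 1. S $$ (i, k) * S $$ (j, k)) * (u j * \<omega>_of x j))"
    unfolding sum_distrib_right by (rule sum.swap)
  also have "\<dots> = (\<Sum>j<n. (if i = j then u i * \<omega>_of x i else 0) - u j * \<omega>_of x j / n)"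
    by (intro sum.cong refl)
      (use assms(2) in \<open>auto simp: row_sums left_diff_distrib simp del: One_nat_def\<close>)
  also have "\<dots> = u i * \<omega>_of x i - (\<Sum>j<n. u j * \<omega>_of x j) / n"
    using assms(2) by (simp add: sum_subtractf sum_divide_distrib)
  finally show ?thesis
    by (simp add: rhs\<phi>_def)
qed

lemma closed_loop_stable: "globally_asymptotically_stable A"
proof (rule strict_lyapunov_function)
  fix \<alpha> \<beta> c \<epsilon> :: real
  assume pos: "\<alpha> > 0" "\<beta> > 0" "c > 0"
    and lower: "\<And>w v e y. (\<Sum>i<n. y i) = 0 \<Longrightarrow> \<alpha> * (sqsum w v y + (\<Sum>i<n. (e i)\<^sup>2)) \<le> lyap \<epsilon> w v e y"
    and upper: "\<And>w v e y. lyap \<epsilon> w v e y \<le> \<beta> * (sqsum w v y + (\<Sum>i<n. (e i)\<^sup>2))"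
    and decrease: "\<And>w v e y. (\<Sum>i<n. y i) = 0 \<Longrightarrow>
      - dissipation w v e y + \<epsilon> * cross_derivative w v e y \<le> - c * (sqsum w v y + (\<Sum>i<n. (e i)\<^sup>2))"
  define F where "F x = lyap \<epsilon> (\<omega>_of x) (V_of x) (\<eta>_of x) (y_of x)" for x
  define D where "D x = - dissipation (\<omega>_of x) (V_of x) (\<eta>_of x) (y_of x)
      + \<epsilon> * cross_derivative (\<omega>_of x) (V_of x) (\<eta>_of x) (y_of x)" for x
  show ?thesis
  proof (rule lyapunov_globally_asymptotically_stable[OF A_carrier pos, where F = F and D = D])
    fix x :: "real \<Rightarrow> real vec" and t :: real
    assume x: "linear_system_solution A x" and t: "t \<ge> 0"
    have carrier: "x t \<in> carrier_vec N"
      and der: "\<And>i. i < N \<Longrightarrow> ((\<lambda>s. x s $ i) has_real_derivative (A *\<^sub>v x t) $ i) (at t within {0..})"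
      using x t A_carrier by (auto simp: linear_system_solution_def)
    have y: "((\<lambda>s. y_of (x s) i) has_real_derivative rhs\<phi> (\<omega>_of (x t)) (y_of (x t)) i)
        (at t within {0..})" if "i < n" for i
      unfolding y_of_closed_loop[OF carrier that, symmetric] y_of_def \<phi>_of_def
      by (intro DERIV_sum DERIV_cmult der) auto
    have \<omega>: "((\<lambda>s. \<omega>_of (x s) i) has_real_derivative
        rhs\<omega> (\<omega>_of (x t)) (V_of (x t)) (\<eta>_of (x t)) (y_of (x t)) i) (at t within {0..})" if "i < n" for i
      unfolding closed_loop_components(1)[OF carrier that, symmetric] \<omega>_of_def
      by (rule der) (use that in simp)
    have V: "((\<lambda>s. V_of (x s) i) has_real_derivative
        rhsV (\<omega>_of (x t)) (V_of (x t)) (y_of (x t)) i) (at t within {0..})" if "i < n" for i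
      unfolding closed_loop_components(2)[OF carrier that, symmetric] V_of_def
      by (rule der) (use that in simp)
    have \<eta>: "((\<lambda>s. \<eta>_of (x s) i) has_real_derivative
        rhs\<eta> (\<omega>_of (x t)) (\<eta>_of (x t)) i) (at t within {0..})" if "i < n" for i
      unfolding closed_loop_components(3)[OF carrier that, symmetric] \<eta>_of_def
      by (rule der) (use that in simp)
    show "((\<lambda>s. F (x s)) has_real_derivative D (x t)) (at t within {0..})"
      unfolding F_def D_def by (rule lyap_has_derivative[OF \<omega> V \<eta> y])
  next
    fix x :: "real vec"
    assume x: "x \<in> carrier_vec N"
    show "\<alpha> * (x \<bullet> x) \<le> F x"
      unfolding F_def scalar_prod_self[OF x] by (rule lower[OF sum_y_of])
    show "F x \<le> \<beta> * (x \<bullet> x)"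
      unfolding F_def scalar_prod_self[OF x] by (rule upper)
    show "D x \<le> - c * (x \<bullet> x)"
      unfolding D_def scalar_prod_self[OF x] by (rule decrease[OF sum_y_of])
  qed
qed

end

section \<open>Instantiation with the graph data\<close>

lemma connected_rtrancl_weights:
  fixes n :: nat and w :: "nat \<Rightarrow> nat \<Rightarrow> real"
  assumes G: "pair_graph G" "pverts G = {0..<n}" "Digraph_Component.connected (with_proj G)"
    and w: "\<And>i j. (i, j) \<in> parcs G \<Longrightarrow> w i j > 0"
    and ij: "i < n" "j < n"
  shows "(i, j) \<in> {(i, j). i < n \<and> j < n \<and> (if (i, j) \<in> parcs G then w i j else 0) > 0}\<^sup>*"
proof -
  interpret pair_graph G by fact
  \<comment> \<open>Arcs of a \<open>pair_graph\<close> are symmetric, so connectedness gives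
    directed reachability.\<close>
  have reach: "(i, j) \<in> rtrancl_on (pverts G) (parcs G)" if "i \<in> pverts G" "j \<in> pverts G" for i j
    using that
    using symmetric_connected_imp_strongly_connected[OF sym_arcs G(3)]
    unfolding strongly_connected_def reachable_def by simp
  have "(i, j) \<in> rtrancl_on (pverts G) (parcs G)"
    by (rule reach) (use ij G(2) in auto)
  then show ?thesis
  proof (induction rule: rtrancl_on_induct)
    case base
    then show ?case by simp
  next
    case (step j k)
    then show ?case
      using w by (intro rtrancl_into_rtrancl[OF step.IH]) (auto simp: G(2))
  qed
qed

theorem theorem1:
  fixes n :: nat
    and G :: "nat pair_pre_digraph"
    and R c\<eta> c\<phi> :: "nat \<Rightarrow> nat \<Rightarrow> real"
    and m C k\<omega> kV kD kI :: "nat \<Rightarrow> real"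
    and Vnom \<gamma> k\<phi> :: real
    and S L\<^sub>R L\<^sub>\<eta> L\<^sub>\<phi> :: "real mat"
  assumes "n \<ge> 1"
    and "pair_graph G" and "pverts G = {0..<n}" and "Digraph_Component.connected (with_proj G)"
    and "edge_weights G R" and "edge_weights G c\<eta>" and "edge_weights G c\<phi>"
    and "L\<^sub>R = weighted_laplacian n G (\<lambda>i j. 1 / R i j)"
    and "L\<^sub>\<eta> = weighted_laplacian n G c\<eta>"
    and "L\<^sub>\<phi> = weighted_laplacian n G c\<phi>"
    and "\<And>i. i < n \<Longrightarrow> m i > 0" and "\<And>i. i < n \<Longrightarrow> C i > 0"
    and "\<And>i. i < n \<Longrightarrow> k\<omega> i > 0" and "\<And>i. i < n \<Longrightarrow> kV i > 0"
    and "\<And>i. i < n \<Longrightarrow> kD i > 0" and "\<And>i. i < n \<Longrightarrow> kI i > 0"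
    and "Vnom > 0" and "\<gamma> > 0"
    and "S \<in> carrier_mat n (n - 1)" and "is_orthogonal (ones_augmented n S)"
    and "k\<phi> > 0" and "L\<^sub>\<phi> = k\<phi> \<cdot>\<^sub>m L\<^sub>R"
    and "\<gamma> > k\<phi> / (4 * Vnom)"
  shows "globally_asymptotically_stable
           (closed_loop_matrix n Vnom \<gamma> m C k\<omega> kV kD kI L\<^sub>R L\<^sub>\<eta> L\<^sub>\<phi> S)"
proof -
  interpret G: pair_graph G by fact
  \<comment> \<open>Extension by zero, because \<open>edge_weights\<close> constrains values on arcs
    only, whereas the locale asks for symmetry and nonnegativity everywhere.\<close>
  define a where "a i j = (if (i, j) \<in> parcs G then 1 / R i j else 0)" for i j
  define b where "b i j = (if (i, j) \<in> parcs G then c\<eta> i j else 0)" for i j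
  have R: "R i j = R j i" "R i j > 0" if "(i, j) \<in> parcs G" for i j
    using \<open>edge_weights G R\<close> that by (auto simp: edge_weights_def)
  have c\<eta>: "c\<eta> i j = c\<eta> j i" "c\<eta> i j > 0" if "(i, j) \<in> parcs G" for i j
    using \<open>edge_weights G c\<eta>\<close> that by (auto simp: edge_weights_def)
  have sym: "(i, j) \<in> parcs G \<longleftrightarrow> (j, i) \<in> parcs G" for i j
    using G.sym_arcs by (auto simp: symmetric_def sym_def)
  interpret hvdc_matrices n a b m C k\<omega> kV kD kI Vnom \<gamma> k\<phi> L\<^sub>R L\<^sub>\<eta> L\<^sub>\<phi> S
  proof unfold_locales
    show "a i j = a j i" "b i j = b j i" for i j
      using R(1) c\<eta>(1) sym by (auto simp: a_def b_def)
    show "a i j \<ge> 0" "b i j \<ge> 0" for i j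
      using R(2) c\<eta>(2) by (auto simp: a_def b_def less_imp_le)
    show "(i, j) \<in> {(i, j). i < n \<and> j < n \<and> a i j > 0}\<^sup>*" if "i < n" "j < n" for i j
      unfolding a_def by (rule connected_rtrancl_weights) (use assms that R in auto)
    show "L\<^sub>R \<in> carrier_mat n n" "L\<^sub>\<eta> \<in> carrier_mat n n"
      by (simp_all add: assms(8,9) weighted_laplacian_def)
    show "(L\<^sub>R *\<^sub>v x) $ i = laplacian n a (\<lambda>j. x $ j) i" if "x \<in> carrier_vec n" "i < n" for x i
      unfolding assms(8) a_def by (rule weighted_laplacian_mult_vec[OF assms(2) that])
    show "(L\<^sub>\<eta> *\<^sub>v x) $ i = laplacian n b (\<lambda>j. x $ j) i" if "x \<in> carrier_vec n" "i < n" for x i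
      unfolding assms(9) b_def by (rule weighted_laplacian_mult_vec[OF assms(2) that])
  qed (use assms in auto)
  show ?thesis by (rule closed_loop_stable)
qed

end
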